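(* Let $k>\ell\ge 1$ and $m\ge 1$ be integers, let $\lambda\in[0,k+\ell-3]$ be an integer, and suppose $p=(k+\ell)m+2+\lambda$ is prime. Let $n\ge 1$. If $A\subset\mathbb F_p^n$ is $(k,\ell)$-sum-free, then $|A|\le (m+1)p^{n-1}$. Moreover, there are in total $\lceil\frac{\lambda+1}{2}\rceil$ mutually non-isomorphic structures of $(k,\ell)$-sum-free sets $A$ with $|A|=(m+1)p^{n-1}$. More precisely, for $j\in[0,\lceil\frac{\lambda+1}2\rceil-1]$ put $a_j:=-(km+1+j)(k-\ell)^{-1}\in\mathbb F_p$ and $$A_{k,\ell,p,j}:=[a_j,a_j+m]\times\mathbb F_p^{n-1}.$$ Then a $(k,\ell)$-sum-free set $A\subset\mathbb F_p^n$ has $|A|=(m+1)p^{n-1}$ if and only if $A$ is isomorphic to $A_{k,\ell,p,j}$ for some such $j$, and the sets $A_{k,\ell,p,j}$ for different $j$ are pairwise non-isomorphic. In particular, if $\lambda\in\{0,1\}$ the extremal set is unique up to isomorphism.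
   Context: For a subset $X$ of an abelian group and an integer $h\ge1$, $hX=\{x_1+\dots+x_h: x_i\in X\}$ denotes the $h$-fold sumset. A nonempty set $A\subseteq\mathbb F_p^n$ is $(k,\ell)$-sum-free if $kA\cap \ell A=\emptyset$. Two subsets of $\mathbb F_p^n$ are isomorphic if some automorphism of the additive group $\mathbb F_p^n$ maps one onto the other. For $a,b\in\mathbb F_p$, $[a,b]$ denotes the set $\{a,a+1,\dots,b\}\subseteq\mathbb F_p$ (an interval, taken cyclically in $\mathbb F_p$); for integers $x\le y$, $[x,y]$ also denotes $\{x,x+1,\dots,y\}$. *)

theory Defs
  imports "HOL-Analysis.Finite_Cartesian_Product" "Berlekamp_Zassenhaus.Finite_Field"
begin

text \<open>\<open>\<F>\<^sub>p\<^sup>n\<close> is the type \<open>'p mod_ring ^ 'n\<close> with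
  \<open>CARD('p) = p\<close> (prime by the class \<open>prime_card\<close>) and \<open>CARD('n) = n\<close>.\<close>

definition hfold_sumset :: "nat \<Rightarrow> 'a::comm_monoid_add set \<Rightarrow> 'a set" where
  "hfold_sumset h X = {(\<Sum>i<h. x i) | x. \<forall>i<h. x i \<in> X}"

definition kl_sum_free :: "nat \<Rightarrow> nat \<Rightarrow> 'a::comm_monoid_add set \<Rightarrow> bool" where
  "kl_sum_free k l A \<longleftrightarrow> A \<noteq> {} \<and> hfold_sumset k A \<inter> hfold_sumset l A = {}"

definition set_isomorphic :: "'a::ab_group_add set \<Rightarrow> 'a set \<Rightarrow> bool" where
  "set_isomorphic A B \<longleftrightarrow>
     (\<exists>f :: 'a \<Rightarrow> 'a. bij f \<and> (\<forall>x y. f (x + y) = f x + f y) \<and> f ` A = B)"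

text \<open>The cyclic interval: start at \<open>a\<close> and add 1 until \<open>b\<close> is reached for the first time.\<close>

definition cyc_interval :: "'p::prime_card mod_ring \<Rightarrow> 'p mod_ring \<Rightarrow> 'p mod_ring set" where
  "cyc_interval a b = {a + of_nat i | i. i \<le> (LEAST d. a + of_nat d = b)}"

definition extremal_start :: "nat \<Rightarrow> nat \<Rightarrow> nat \<Rightarrow> nat \<Rightarrow> 'p::prime_card mod_ring" where
  "extremal_start k l m j = - of_nat (k * m + 1 + j) * inverse (of_nat k - of_nat l)"

text \<open>The product of an interval with \<open>\<F>\<^sub>p\<^bsup>n-1\<^esup>\<close>, as a subset of \<open>\<F>\<^sub>p\<^sup>n\<close>: coordinate
  \<open>c\<close> carries the interval factor, the other coordinates are free.  An index type has no
  canonical first element, so the coordinate is a parameter.\<close>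

definition extremal_set ::
    "'n::finite \<Rightarrow> nat \<Rightarrow> nat \<Rightarrow> nat \<Rightarrow> nat \<Rightarrow> ('p::prime_card mod_ring ^ 'n) set" where
  "extremal_set c k l m j =
     {x. x $ c \<in> cyc_interval (extremal_start k l m j) (extremal_start k l m j + of_nat m)}"

definition extremal_sum_free ::
    "nat \<Rightarrow> nat \<Rightarrow> nat \<Rightarrow> ('p::prime_card mod_ring ^ 'n::finite) set \<Rightarrow> bool" where
  "extremal_sum_free k l m A \<longleftrightarrow>
     kl_sum_free k l A \<and> card A = (m + 1) * CARD('p) ^ (CARD('n) - 1)"

end

theory Submission
  imports Defs "HOL-Library.Set_Algebras" "HOL-Analysis.Cartesian_Space"
begin

text \<open>The isoperimetric method of Hamidoune: among the sets \<open>X\<close> with \<open>X + A \<noteq> G\<close>, the boundary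
  \<open>|X + A| - |X|\<close> is minimised by a subgroup \<open>H\<close>.  Adding copies of \<open>A\<close> one at a time, a sum-free set
  \<open>A\<close> in \<open>\<F>\<^sub>p\<^sup>n\<close> thus satisfies \<open>2|A| + (k + l - 2)(|H + A| - |H|) \<le> p\<^sup>n\<close>.  If \<open>|A| \<ge> (m + 1)p\<^bsup>n-1\<^esup>\<close>, this
  forces \<open>H\<close> to be a hyperplane and \<open>A\<close> to be a union of exactly \<open>m + 1\<close> cosets of \<open>H\<close>, which reduces
  everything to \<open>\<F>\<^sub>p\<close>.  There Vosper's theorem leaves only arithmetic progressions, since otherwise
  \<open>|kA| + |lA| \<ge> (k + l)(m + 1) > p\<close>.  After dilation the progression is an interval \<open>[a, a + m]\<close>, and
  disjointness of \<open>kA\<close> and \<open>lA\<close> says \<open>(k - l)a = -(km + 1 + j)\<close> with \<open>0 \<le> j \<le> \<lambda>\<close>; the reflection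
  \<open>x \<mapsto> -x\<close> exchanges \<open>j\<close> and \<open>\<lambda> - j\<close>.\<close>

section \<open>Atoms in finite abelian groups\<close>

text \<open>In a finite group this counts \<open>(X + A) - X\<close> when \<open>0\<close> lies in
  \<open>A\<close>; unlike that count, it does not change when \<open>A\<close> is
  translated.\<close>

definition boundary :: "'a::ab_group_add set \<Rightarrow> 'a set \<Rightarrow> int" where
  "boundary A X = int (card (X + A)) - int (card X)"

text \<open>Requiring \<open>q\<close> points outside \<open>X + A\<close> makes the condition
  stable under the duality sending \<open>X\<close> to the negative of the complement of
  \<open>X + A\<close>. Subgroups come from \<open>q = 1\<close>, Vosper's theorem from
  \<open>q = 2\<close>.\<close>

definition admissible :: "nat \<Rightarrow> 'a::ab_group_add set \<Rightarrow> 'a set \<Rightarrow> bool" where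
  "admissible q A X \<longleftrightarrow> q \<le> card X \<and> card (X + A) + q \<le> CARD('a)"

definition is_atom :: "nat \<Rightarrow> 'a::ab_group_add set \<Rightarrow> 'a set \<Rightarrow> bool" where
  "is_atom q A M \<longleftrightarrow> admissible q A M \<and>
     (\<forall>X. admissible q A X \<longrightarrow> boundary A M < boundary A X \<or>
          boundary A M = boundary A X \<and> card M \<le> card X)"

lemma card_sing_plus: "card ({a} + A) = card A" for A :: "'a::ab_group_add set"
  by (metis add.commute card_plus_sing)

lemma mem_sing_plus: "x \<in> {d} + S \<longleftrightarrow> x - d \<in> S" for x :: "'a::ab_group_add"
  using set_minus_plus[of x d S] by (simp add: elt_set_plus_def set_plus_def)

lemma card_le_card_plus:
  fixes A X :: "'a::{ab_group_add,finite} set"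
  assumes "A \<noteq> {}"
  shows "card X \<le> card (X + A)"
proof -
  obtain a where "a \<in> A" using assms by blast
  then have "X + {a} \<subseteq> X + A" by (intro set_plus_mono2) auto
  then have "card (X + {a}) \<le> card (X + A)" by (intro card_mono) auto
  then show ?thesis by (simp add: card_plus_sing)
qed

lemma atom_exists:
  fixes A X :: "'a::{ab_group_add,finite} set"
  assumes "admissible q A X"
  obtains M where "is_atom q A M"
proof -
  define b where "b = Min (boundary A ` Collect (admissible q A))"
  have b_le: "b \<le> boundary A Y" if "admissible q A Y" for Y
    unfolding b_def by (rule Min_le) (use that in auto)
  have "b \<in> boundary A ` Collect (admissible q A)"
    unfolding b_def by (rule Min_in) (use assms in auto)
  then obtain Y where "admissible q A Y \<and> boundary A Y = b" by auto
  from ex_has_least_nat[of "\<lambda>Y. admissible q A Y \<and> boundary A Y = b", OF this, of card]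
  obtain M where "admissible q A M" "boundary A M = b"
    "\<forall>Y. admissible q A Y \<and> boundary A Y = b \<longrightarrow> card M \<le> card Y" by blast
  then have "is_atom q A M" unfolding is_atom_def using b_le by (metis order_le_imp_less_or_eq)
  then show thesis by (rule that)
qed

lemma atom_translate:
  fixes A M :: "'a::{ab_group_add,finite} set"
  assumes "is_atom q A M"
  shows "is_atom q A ({x} + M)"
  using assms by (simp add: is_atom_def admissible_def boundary_def add.assoc card_sing_plus)

text \<open>If \<open>y\<close> lies outside \<open>X + A\<close>, then no \<open>y - a\<close> with
  \<open>a\<close> in \<open>A\<close> can lie in \<open>X\<close>.\<close>

lemma plus_uminus_Compl_subset:
  fixes A X :: "'a::ab_group_add set"
  shows "uminus ` (- (X + A)) + A \<subseteq> uminus ` (- X)"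
proof
  fix z assume "z \<in> uminus ` (- (X + A)) + A"
  then obtain y a where *: "z = - y + a" "y \<notin> X + A" "a \<in> A" by (auto elim!: set_plus_elim)
  have "y - a \<notin> X" using * by (metis diff_add_cancel set_plus_intro)
  moreover have "z = - (y - a)" using * by simp
  ultimately show "z \<in> uminus ` (- X)" by blast
qed

lemma card_uminus_Compl: "card (uminus ` (- X)) = CARD('a) - card X"
  for X :: "'a::{ab_group_add,finite} set"
proof -
  have "card (uminus ` (- X)) = card (- X)" by (rule card_image) simp
  also have "\<dots> = card (UNIV - X)" by (simp only: Compl_eq_Diff_UNIV)
  also have "\<dots> = CARD('a) - card X" by (rule card_Diff_subset) auto
  finally show ?thesis .
qed

text \<open>The dual \<open>- (UNIV - (M + A))\<close> of an atom is again admissible, with no larger boundary.\<close>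

lemma atom_dual_size:
  fixes A M :: "'a::{ab_group_add,finite} set"
  assumes "is_atom q A M"
  shows "card M + card (M + A) \<le> CARD('a)"
proof -
  let ?D = "uminus ` (- (M + A))"
  have le: "card (M + A) \<le> CARD('a)" "card M \<le> CARD('a)" by (auto intro: card_mono)
  have D: "card ?D = CARD('a) - card (M + A)" by (rule card_uminus_Compl)
  have DA: "card (?D + A) \<le> CARD('a) - card M"
    using card_mono[OF _ plus_uminus_Compl_subset[of M A]] by (simp add: card_uminus_Compl)
  have "admissible q A ?D"
    using assms D DA le unfolding is_atom_def admissible_def by linarith
  \<comment> \<open>By \<open>D\<close> and \<open>DA\<close>, the boundary of \<open>?D\<close> is
    at most that of \<open>M\<close>, hence equal to it, and the tie-break by size applies.\<close>
  then have "card M \<le> card ?D"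
    using assms D DA le unfolding is_atom_def boundary_def by force
  then show ?thesis using D le by linarith
qed

text \<open>The boundary is submodular, and by the dual bound the union of two atoms meeting in at
  least \<open>q\<close> points is still admissible.\<close>

lemma atoms_intersecting_eq:
  fixes A M F :: "'a::{ab_group_add,finite} set"
  assumes M: "is_atom q A M" and F: "is_atom q A F" and q: "q \<le> card (M \<inter> F)"
  shows "M = F"
proof -
  have eq: "card M = card F" "boundary A M = boundary A F"
    using M F unfolding is_atom_def by force+
  have I: "(M \<inter> F) + A \<subseteq> (M + A) \<inter> (F + A)" by (auto simp: set_plus_def)
  have "card ((M \<inter> F) + A) \<le> card (M + A)" using I by (intro card_mono) auto
  then have admI: "admissible q A (M \<inter> F)"
    using M q unfolding is_atom_def admissible_def by simp
  have sub: "card ((M \<union> F) + A) + card ((M \<inter> F) + A) \<le> card (M + A) + card (F + A)"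
  proof -
    have "card ((M \<inter> F) + A) \<le> card ((M + A) \<inter> (F + A))" using I by (intro card_mono) auto
    moreover have "card (M + A) + card (F + A) = card ((M + A) \<union> (F + A)) + card ((M + A) \<inter> (F + A))"
      by (rule card_Un_Int) auto
    ultimately show ?thesis by (simp add: Un_set_plus)
  qed
  have cards: "card M + card F = card (M \<union> F) + card (M \<inter> F)" by (rule card_Un_Int) auto
  have bI: "boundary A M \<le> boundary A (M \<inter> F)" using M admI unfolding is_atom_def by force
  have dual: "card M + card (M + A) \<le> CARD('a)" using M by (rule atom_dual_size)
  \<comment> \<open>\<open>sub\<close> and \<open>bI\<close> bound the sumset of the union by
    \<open>card (M + A) + card M - card (M \<inter> F)\<close>, and \<open>dual\<close> bounds the
    first two terms.\<close>
  have "card ((M \<union> F) + A) + q \<le> CARD('a)"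
    using sub bI dual q eq unfolding boundary_def by linarith
  moreover have "q \<le> card (M \<union> F)" using q cards eq card_mono[of M "M \<inter> F"] by simp
  ultimately have "admissible q A (M \<union> F)" unfolding admissible_def by simp
  then have "boundary A M \<le> boundary A (M \<union> F)" using M unfolding is_atom_def by force
  \<comment> \<open>The boundaries of union and intersection add up to at most twice the minimum,
    and neither is below it, so the intersection attains the minimum too.\<close>
  then have "boundary A (M \<inter> F) \<le> boundary A M"
    using sub cards eq unfolding boundary_def by linarith
  then have "card M \<le> card (M \<inter> F)" using M admI unfolding is_atom_def by force
  then have "M \<inter> F = M" "M \<inter> F = F"
    using eq card_seteq[of M "M \<inter> F"] card_seteq[of F "M \<inter> F"] by auto
  then show ?thesis by simp
qed

section \<open>Subgroups as minimisers of the boundary\<close>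

definition add_subgroup :: "'a::ab_group_add set \<Rightarrow> bool" where
  "add_subgroup H \<longleftrightarrow> 0 \<in> H \<and> (\<forall>x\<in>H. \<forall>y\<in>H. x - y \<in> H)"

lemma add_subgroup_uminus: "add_subgroup H \<Longrightarrow> x \<in> H \<Longrightarrow> - x \<in> H"
  unfolding add_subgroup_def by (metis diff_0)

lemma add_subgroup_add: "add_subgroup H \<Longrightarrow> x \<in> H \<Longrightarrow> y \<in> H \<Longrightarrow> x + y \<in> H"
  using add_subgroup_uminus[of H y] unfolding add_subgroup_def by (metis diff_minus_eq_add)

text \<open>Translate a 1-atom so that it contains \<open>0\<close>. For \<open>y\<close> in the
  resulting \<open>H\<close>, the translate of \<open>H\<close> by \<open>- y\<close> contains
  \<open>0\<close> as well, so the two atoms meet and coincide; hence \<open>H\<close> is closed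
  under differences.\<close>

theorem subgroup_minimizes_boundary:
  fixes A :: "'a::{ab_group_add,finite} set"
  assumes "A \<noteq> UNIV"
  obtains H where "add_subgroup H" "H + A \<noteq> UNIV"
    "\<And>X. X \<noteq> {} \<Longrightarrow> X + A \<noteq> UNIV \<Longrightarrow> boundary A H \<le> boundary A X"
proof -
  have adm: "admissible 1 A X \<longleftrightarrow> X \<noteq> {} \<and> X + A \<noteq> UNIV" for X
  proof -
    have "card (X + A) + 1 \<le> CARD('a) \<longleftrightarrow> X + A \<noteq> UNIV"
      using card_mono[of UNIV "X + A"] card_eq_UNIV_imp_eq_UNIV[of "X + A"]
      by (cases "card (X + A) = CARD('a)") auto
    then show ?thesis unfolding admissible_def by (simp add: Suc_le_eq card_gt_0_iff)
  qed
  have "admissible 1 A {0}" using assms unfolding adm by simp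
  then obtain M where M: "is_atom 1 A M" by (rule atom_exists)
  then have "M \<noteq> {}" using adm unfolding is_atom_def by blast
  then obtain x where x: "x \<in> M" by blast
  define H where "H = {- x} + M"
  have H: "is_atom 1 A H" unfolding H_def by (rule atom_translate[OF M])
  have 0: "0 \<in> H" unfolding H_def using x by (simp add: mem_sing_plus)
  have "{- y} + H = H" if "y \<in> H" for y
  proof (rule atoms_intersecting_eq[OF atom_translate[OF H] H])
    have "0 \<in> {- y} + H" using that by (simp add: mem_sing_plus)
    then have "({- y} + H) \<inter> H \<noteq> {}" using 0 by blast
    then show "1 \<le> card (({- y} + H) \<inter> H)" by (simp add: Suc_le_eq card_gt_0_iff)
  qed
  then have "x - y \<in> H" if "x \<in> H" "y \<in> H" for x y
    using that set_plus_intro[of "- y" "{- y}" x H] by simp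
  then have "add_subgroup H" unfolding add_subgroup_def using 0 by blast
  moreover have "H + A \<noteq> UNIV" using H adm unfolding is_atom_def by blast
  moreover have "boundary A H \<le> boundary A X" if "X \<noteq> {}" "X + A \<noteq> UNIV" for X
  proof -
    have "admissible 1 A X" using that unfolding adm by simp
    then show ?thesis using H unfolding is_atom_def by force
  qed
  ultimately show thesis by (rule that)
qed

text \<open>Lagrange's theorem in relative form: \<open>H + A\<close> is partitioned into cosets of
  \<open>H\<close>. The case where \<open>A\<close> is the whole group is the usual theorem.\<close>

lemma add_subgroup_card_dvd_plus:
  fixes H A :: "'a::{ab_group_add,finite} set"
  assumes "add_subgroup H"
  shows "card H dvd card (H + A)"
proof (rule equiv_imp_dvd_card)
  define r where "r = {(x, y). x \<in> H + A \<and> y \<in> H + A \<and> y - x \<in> H}"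
  show "equiv (H + A) r"
  proof (rule equivI)
    show "refl_on (H + A) r" using assms by (auto simp: refl_on_def r_def add_subgroup_def)
    show "sym r"
    proof (rule symI)
      fix x y assume "(x, y) \<in> r"
      then show "(y, x) \<in> r" using add_subgroup_uminus[OF assms, of "y - x"] by (simp add: r_def)
    qed
    show "trans r"
    proof (rule transI)
      fix x y z assume "(x, y) \<in> r" "(y, z) \<in> r"
      then show "(x, z) \<in> r" using add_subgroup_add[OF assms, of "z - y" "y - x"] by (simp add: r_def)
    qed
  qed (auto simp: r_def)
  fix X assume "X \<in> (H + A) // r"
  then obtain x where x: "x \<in> H + A" "X = r `` {x}" by (auto elim: quotientE)
  \<comment> \<open>The classes of \<open>r\<close> are confined to \<open>H + A\<close>; this shows
    that they are nevertheless whole cosets.\<close>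
  have "y \<in> H + A" if "y - x \<in> H" for y
  proof -
    obtain h a where ha: "x = h + a" "h \<in> H" "a \<in> A" using x(1) by (rule set_plus_elim)
    have "(y - x) + h \<in> H" using add_subgroup_add[OF assms] that ha(2) by blast
    then have "((y - x) + h) + a \<in> H + A" using ha(3) by (rule set_plus_intro)
    then show ?thesis using ha(1) by (simp add: algebra_simps)
  qed
  then have "X = {x} + H" using x by (auto simp: r_def mem_sing_plus)
  then show "card H dvd card X" by (simp add: card_sing_plus)
qed simp

lemma UNIV_plus:
  fixes B :: "'a::ab_group_add set"
  assumes "B \<noteq> {}"
  shows "UNIV + B = UNIV"
proof -
  obtain b where "b \<in> B" using assms by blast
  then have "z \<in> UNIV + B" for z using set_plus_intro[of "z - b" UNIV b B] by simp
  then show ?thesis by blast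
qed

lemma add_subgroup_card_dvd:
  fixes H :: "'a::{ab_group_add,finite} set"
  assumes "add_subgroup H"
  shows "card H dvd CARD('a)"
proof -
  have "H + UNIV = UNIV" using assms UNIV_plus[of H] by (auto simp: add.commute add_subgroup_def)
  then show ?thesis using add_subgroup_card_dvd_plus[OF assms, of UNIV] by simp
qed

section \<open>The theorems of Cauchy--Davenport and Vosper\<close>

lemma of_nat_mod_ring_eq_iff:
  assumes "i < CARD('p::prime_card)" "j < CARD('p)"
  shows "(of_nat i :: 'p mod_ring) = of_nat j \<longleftrightarrow> i = j"
  using assms by (auto simp: of_nat_eq_iff_cong_CHAR cong_def)

lemma ex_of_nat_mult:
  fixes d y :: "'p::prime_card mod_ring"
  assumes "d \<noteq> 0"
  obtains i where "i < CARD('p)" "y = of_nat i * d"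
proof -
  obtain i where "i < CARD('p)" "y / d = of_nat i" using surj_of_nat_mod_ring by blast
  then show thesis using that[of i] assms by (simp add: field_simps)
qed

text \<open>A nonzero \<open>d\<close> generates the additive group, so steps of \<open>- d\<close>
  from any point of \<open>S\<close> reach everything.\<close>

lemma closed_under_diff_UNIV:
  fixes S :: "'p::prime_card mod_ring set"
  assumes "S \<noteq> {}" "d \<noteq> 0" "\<And>x. x \<in> S \<Longrightarrow> x - d \<in> S"
  shows "S = UNIV"
proof -
  obtain x where x: "x \<in> S" using assms by blast
  have *: "x - of_nat i * d \<in> S" for i
  proof (induction i)
    case (Suc i)
    then show ?case using assms(3)[OF Suc] by (simp add: algebra_simps)
  qed (use x in simp)
  have "y \<in> S" for y
  proof -
    obtain i where "x - y = of_nat i * d" by (rule ex_of_nat_mult[OF assms(2)])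
    then have "y = x - of_nat i * d" by (metis diff_diff_eq2 add_diff_cancel_left')
    then show ?thesis using * by simp
  qed
  then show ?thesis by blast
qed

lemma translate_invariant_UNIV:
  fixes S :: "'p::prime_card mod_ring set"
  assumes "S \<noteq> {}" "d \<noteq> 0" "{d} + S = S"
  shows "S = UNIV"
proof (rule closed_under_diff_UNIV[OF assms(1,2)])
  fix x assume "x \<in> S"
  then have "x \<in> {d} + S" using assms(3) by simp
  then show "x - d \<in> S" by (auto elim!: set_plus_elim)
qed

text \<open>In a group of prime order the minimising subgroup is trivial, since the whole group is
  excluded by \<open>H + A \<noteq> UNIV\<close>. So the least boundary is that of
  \<open>{0}\<close>, which is \<open>card A - 1\<close>.\<close>

theorem cauchy_davenport:
  fixes A X :: "'p::prime_card mod_ring set"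
  assumes "X \<noteq> {}" "A \<noteq> {}" "X + A \<noteq> UNIV"
  shows "card X + card A \<le> card (X + A) + 1"
proof -
  have "A \<noteq> UNIV" using UNIV_plus[OF assms(1)] assms(3) by (auto simp: add.commute)
  then obtain H where H: "add_subgroup H" "H + A \<noteq> UNIV"
    "\<And>X. X \<noteq> {} \<Longrightarrow> X + A \<noteq> UNIV \<Longrightarrow> boundary A H \<le> boundary A X"
    by (rule subgroup_minimizes_boundary) blast
  have "card H dvd CARD('p)" using add_subgroup_card_dvd[OF H(1)] by simp
  then have "card H = 1 \<or> card H = CARD('p)" using prime_card[where 'a='p] by (auto simp: prime_nat_iff)
  moreover have "H \<noteq> UNIV" using H(2) UNIV_plus[OF assms(2)] by blast
  ultimately have "card H = 1" using card_eq_UNIV_imp_eq_UNIV[of H] by auto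
  then have "H = {0}" using H(1) unfolding add_subgroup_def by (auto simp: card_1_singleton_iff)
  then show ?thesis using H(3)[OF assms(1,3)] unfolding boundary_def by simp
qed

section \<open>Arithmetic progressions in the prime field\<close>

text \<open>Using exactly \<open>card S\<close> indices forces the listed terms to be
  distinct.\<close>

definition is_arith_prog :: "'p::prime_card mod_ring set \<Rightarrow> bool" where
  "is_arith_prog S \<longleftrightarrow> (\<exists>a d. d \<noteq> 0 \<and> S = (\<lambda>i. a + of_nat i * d) ` {..<card S})"

lemma downward_closed_eq_lessThan:
  fixes T :: "nat set"
  assumes "finite T" "\<And>t. Suc t \<in> T \<Longrightarrow> t \<in> T"
  shows "T = {..<card T}"
proof -
  obtain n0 where "n0 \<notin> T" using assms(1) ex_new_if_finite infinite_UNIV_nat by blast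
  define n where "n = (LEAST n. n \<notin> T)"
  have n: "n \<notin> T" unfolding n_def using \<open>n0 \<notin> T\<close> by (rule LeastI)
  have "t \<in> T" if "t < n" for t using that not_less_Least unfolding n_def by blast
  moreover have "t \<notin> T" if "n \<le> t" for t using that n by (induction rule: dec_induct) (use assms in auto)
  ultimately have "T = {..<n}" by (auto simp: not_less[symmetric])
  then show ?thesis by simp
qed

text \<open>The bound says that at most one element of \<open>S\<close> lacks its predecessor
  \<open>x - d\<close> in \<open>S\<close>. Measured in steps of \<open>d\<close> from that element,
  the indices of \<open>S\<close> form an initial segment.\<close>

lemma arith_prog_if_small_doubling:
  fixes S :: "'p::prime_card mod_ring set"
  assumes "S \<noteq> {}" "S \<noteq> UNIV" "d \<noteq> 0" "card (S \<union> ({d} + S)) \<le> card S + 1"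
  shows "is_arith_prog S"
proof -
  obtain a where a: "a \<in> S" "a - d \<notin> S" using closed_under_diff_UNIV[of S d] assms by blast
  have "card (S \<union> ({d} + S)) = card (S - ({d} + S)) + card ({d} + S)"
    by (subst card_Un_disjoint[symmetric]) (auto intro: arg_cong[where f=card])
  then have "card (S - ({d} + S)) \<le> 1" using assms(4) by (simp add: card_sing_plus)
  then have uniq: "x = a" if "x \<in> S" "x - d \<notin> S" for x
    using that a by (auto simp: mem_sing_plus card_le_Suc0_iff_eq)
  define T where "T = {t. t < CARD('p) \<and> a + of_nat t * d \<in> S}"
  have T: "T = {..<card T}"
  proof (rule downward_closed_eq_lessThan)
    fix t assume t: "Suc t \<in> T"
    \<comment> \<open>Since \<open>Suc t\<close> is below the order of the field, the term at
      \<open>Suc t\<close> is not the start \<open>a\<close>, so its predecessor is in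
      \<open>S\<close>.\<close>
    then have "of_nat (Suc t) \<noteq> (0::'p mod_ring)"
      using of_nat_mod_ring_eq_iff[of "Suc t" 0, where 'p='p] by (simp add: T_def)
    then have "a + of_nat (Suc t) * d \<noteq> a" using assms(3) by simp
    then have "a + of_nat (Suc t) * d - d \<in> S" using uniq t unfolding T_def by blast
    then show "t \<in> T" using t unfolding T_def by (simp add: algebra_simps)
  qed (simp add: T_def)
  have "S = (\<lambda>i. a + of_nat i * d) ` T"
  proof -
    have "x \<in> (\<lambda>i. a + of_nat i * d) ` T" if "x \<in> S" for x
    proof -
      obtain i where "i < CARD('p)" "x - a = of_nat i * d" by (rule ex_of_nat_mult[OF assms(3)])
      then have "x = a + of_nat i * d" by (simp add: algebra_simps)
      moreover have "i \<in> T" using \<open>i < _\<close> that calculation by (simp add: T_def)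
      ultimately show ?thesis by blast
    qed
    then show ?thesis by (auto simp: T_def)
  qed
  moreover have "inj_on (\<lambda>i. a + of_nat i * d) T"
    using assms(3) by (auto simp: inj_on_def T_def of_nat_mod_ring_eq_iff)
  ultimately have S: "S = (\<lambda>i. a + of_nat i * d) ` {..<card T}" and "card S = card T"
    using T by (simp_all add: card_image)
  then have "S = (\<lambda>i. a + of_nat i * d) ` {..<card S}" by simp
  then show ?thesis unfolding is_arith_prog_def using assms(3) by blast
qed

text \<open>The difference form of the Sidon property: each nonzero \<open>x\<close> is the
  difference of at most one pair from \<open>S\<close>.\<close>

definition sidon :: "'a::ab_group_add set \<Rightarrow> bool" where
  "sidon S \<longleftrightarrow> (\<forall>x. x \<noteq> 0 \<longrightarrow> card (({x} + S) \<inter> S) \<le> 1)"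

lemma card_translates_Int: "card (({a} + S) \<inter> ({b} + S)) = card (({a - b} + S) \<inter> S)"
  for S :: "'a::ab_group_add set"
proof -
  have "({a} + S) \<inter> ({b} + S) = {b} + (({a - b} + S) \<inter> S)"
    by (auto simp: mem_sing_plus)
  then show ?thesis by (simp add: card_sing_plus)
qed

text \<open>Inclusion-exclusion for three translates of \<open>S\<close> by elements of
  \<open>T\<close>, any two of which share at most one point.\<close>

lemma sidon_card_plus:
  fixes S T :: "'a::{ab_group_add,finite} set"
  assumes "sidon S" "3 \<le> card T"
  shows "3 * card S \<le> card (S + T) + 3"
proof -
  obtain U where "U \<subseteq> T" "card U = 3" using assms(2) by (meson obtain_subset_with_card_n)
  then obtain a b c where abc: "U = {a, b, c}" "a \<noteq> b" "a \<noteq> c" "b \<noteq> c"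
    by (auto simp: card_3_iff)
  define P Q R where "P = {a} + S" and "Q = {b} + S" and "R = {c} + S"
  have sz: "card P = card S" "card Q = card S" "card R = card S"
    by (auto simp: P_def Q_def R_def card_sing_plus)
  have le1: "card (P \<inter> Q) \<le> 1" "card (P \<inter> R) \<le> 1" "card (Q \<inter> R) \<le> 1"
    using assms(1) abc unfolding P_def Q_def R_def sidon_def by (auto simp: card_translates_Int)
  have "card (P \<union> Q) + card (P \<inter> Q) = 2 * card S" using card_Un_Int[of P Q] sz by simp
  moreover have "card ((P \<union> Q) \<union> R) + card ((P \<union> Q) \<inter> R) = card (P \<union> Q) + card R"
    by (rule card_Un_Int[symmetric]) auto
  moreover have "card ((P \<union> Q) \<inter> R) \<le> card (P \<inter> R) + card (Q \<inter> R)"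
    by (simp add: Int_Un_distrib2 card_Un_le)
  moreover have "card ((P \<union> Q) \<union> R) \<le> card (S + T)"
    by (rule card_mono) (use \<open>U \<subseteq> T\<close> abc in \<open>auto simp: P_def Q_def R_def set_plus_def add.commute\<close>)
  ultimately show ?thesis using le1 sz by linarith
qed

text \<open>A 2-atom that meets a translate of itself in two points equals that translate, and a
  proper nonempty subset of the prime field has no nonzero period.\<close>

lemma atom_sidon:
  fixes A M :: "'p::prime_card mod_ring set"
  assumes "is_atom 2 A M" "M \<noteq> UNIV"
  shows "sidon M"
  unfolding sidon_def
proof (intro allI impI, rule ccontr)
  fix x :: "'p mod_ring" assume x: "x \<noteq> 0" "\<not> card (({x} + M) \<inter> M) \<le> 1"
  then have "{x} + M = M"
    by (intro atoms_intersecting_eq[OF atom_translate[OF assms(1)] assms(1)]) auto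
  moreover have "M \<noteq> {}" using assms(1) by (auto simp: is_atom_def admissible_def)
  ultimately show False using translate_invariant_UNIV x assms(2) by blast
qed

text \<open>An atom does at least as well as \<open>X\<close>, so its boundary is below
  \<open>card A\<close>; Cauchy-Davenport gives the matching lower bound
  \<open>card A - 1\<close>.\<close>

lemma critical_atom:
  fixes A X :: "'p::prime_card mod_ring set"
  assumes "A \<noteq> {}" "admissible 2 A X" "card (X + A) < card X + card A"
  obtains M where "is_atom 2 A M" "2 \<le> card M" "card (M + A) + 2 \<le> CARD('p)"
    "card M + card A = card (M + A) + 1"
proof -
  obtain M where M: "is_atom 2 A M" using assms(2) by (rule atom_exists)
  then have adm: "2 \<le> card M" "card (M + A) + 2 \<le> CARD('p)"
    by (auto simp: is_atom_def admissible_def)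
  have "card M + card A \<le> card (M + A) + 1"
    using adm assms(1) by (intro cauchy_davenport) auto
  moreover have "boundary A M \<le> boundary A X" using M assms(2) unfolding is_atom_def by force
  then have "card (M + A) < card M + card A" using assms(3) unfolding boundary_def by linarith
  ultimately show thesis using that[OF M adm] by simp
qed

text \<open>Adding a pair \<open>{u, v}\<close> amounts, up to translation, to joining
  \<open>A\<close> with its shift by \<open>v - u\<close>, and criticality allows only one new
  point.\<close>

lemma arith_prog_if_two_critical:
  fixes A M :: "'p::prime_card mod_ring set"
  assumes "A \<noteq> {}" "A \<noteq> UNIV" "card M = 2" "card M + card A = card (M + A) + 1"
  shows "is_arith_prog A"
proof -
  obtain u v where uv: "M = {u, v}" "u \<noteq> v" using assms(3) by (auto simp: card_2_iff)
  have "M + A = ({u} + A) \<union> ({v} + A)" unfolding uv by (auto simp: set_plus_def)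
  also have "\<dots> = {u} + (A \<union> ({v - u} + A))" by (auto simp: mem_sing_plus)
  finally have "M + A = {u} + (A \<union> ({v - u} + A))" .
  then have "card (M + A) = card (A \<union> ({v - u} + A))" by (simp add: card_sing_plus)
  then show ?thesis using assms uv by (intro arith_prog_if_small_doubling[of A "v - u"]) auto
qed

text \<open>Three consecutive terms realise the common difference twice.\<close>

lemma arith_prog_not_sidon:
  fixes S :: "'p::prime_card mod_ring set"
  assumes "is_arith_prog S" "3 \<le> card S"
  shows "\<not> sidon S"
proof -
  obtain a d where d: "d \<noteq> 0" and S: "S = (\<lambda>i. a + of_nat i * d) ` {..<card S}"
    using assms(1) unfolding is_arith_prog_def by blast
  have in_S: "a + of_nat i * d \<in> S" if "i < 3" for i by (subst S) (use that assms(2) in auto)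
  have "a \<in> S" "a + d \<in> S" "a + d + d \<in> S" using in_S[of 0] in_S[of 1] in_S[of 2] by (simp_all add: algebra_simps)
  then have "{a + d, a + d + d} \<subseteq> ({d} + S) \<inter> S" by (auto simp: set_plus_def add.commute)
  then have "card {a + d, a + d + d} \<le> card (({d} + S) \<inter> S)" by (intro card_mono) auto
  moreover have "card {a + d, a + d + d} = 2" using d by (intro card_2_iff[THEN iffD2]) force
  ultimately have "\<not> card (({d} + S) \<inter> S) \<le> 1" by simp
  then show ?thesis using d unfolding sidon_def by blast
qed

text \<open>If \<open>A\<close> is not a progression, a 2-atom \<open>M\<close> of \<open>A\<close> and then a 2-atom \<open>N\<close> of \<open>M\<close> are Sidon
  sets with at least three elements, and the sum of two such sets is too large.\<close>

theorem vosper: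
  fixes A X :: "'p::prime_card mod_ring set"
  assumes "2 \<le> card X" "2 \<le> card A" "card (X + A) + 2 \<le> CARD('p)" "\<not> is_arith_prog A"
  shows "card X + card A \<le> card (X + A)"
proof (rule ccontr)
  assume "\<not> ?thesis"
  then have lt: "card (X + A) < card X + card A" by simp
  have ne: "B \<noteq> {}" if "2 \<le> card B" for B :: "'p mod_ring set" using that by auto
  have neU: "C \<noteq> UNIV" if "2 \<le> card B" "card (B + C) + 2 \<le> CARD('p)" for B C :: "'p mod_ring set"
    using that card_le_card_plus[OF ne[OF that(1)], of C] by (auto simp: add.commute)
  have "admissible 2 A X" using assms by (simp add: admissible_def)
  then obtain M where M: "is_atom 2 A M" "2 \<le> card M" "card (M + A) + 2 \<le> CARD('p)"
    "card M + card A = card (M + A) + 1"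
    by (rule critical_atom[OF ne[OF assms(2)] _ lt])
  have "card M \<noteq> 2"
    using arith_prog_if_two_critical[OF ne[OF assms(2)] neU[OF M(2,3)] _ M(4)] assms(4) by blast
  then have M3: "3 \<le> card M" using M(2) by linarith
  have "M \<noteq> UNIV" using neU[OF assms(2), of M] M(3) by (simp add: add.commute)
  then have sM: "sidon M" using atom_sidon M(1) by blast
  \<comment> \<open>The roles are exchanged: \<open>A\<close> now serves as the test set that makes
    \<open>M\<close> critical.\<close>
  have adm: "admissible 2 M A" using assms(2) M(3) by (simp add: admissible_def add.commute)
  have ltM: "card (A + M) < card A + card M" using M(4) by (simp add: add.commute)
  obtain N where N: "is_atom 2 M N" "2 \<le> card N" "card (N + M) + 2 \<le> CARD('p)"
    "card N + card M = card (N + M) + 1"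
    by (rule critical_atom[OF ne[OF M(2)] adm ltM])
  have "card N \<noteq> 2"
    using arith_prog_if_two_critical[OF ne[OF M(2)] \<open>M \<noteq> UNIV\<close> _ N(4)]
      arith_prog_not_sidon[OF _ M3] sM by blast
  then have N3: "3 \<le> card N" using N(2) by linarith
  have "N \<noteq> UNIV" using neU[OF M(2), of N] N(3) by (simp add: add.commute)
  then have sN: "sidon N" using atom_sidon N(1) by blast
  have "3 * card N \<le> card (N + M) + 3" by (rule sidon_card_plus[OF sN M3])
  moreover have "3 * card M \<le> card (N + M) + 3"
    using sidon_card_plus[OF sM N3] by (simp add: add.commute)
  \<comment> \<open>The two bounds add up to \<open>card N + card M \<le> 4\<close>, because
    \<open>N + M\<close> has one element fewer than \<open>card N + card M\<close>.\<close>
  ultimately show False using N(4) M3 N3 by linarith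
qed

section \<open>Iterated sumsets and sum-free sets\<close>

lemma hfold_sumset_0 [simp]: "hfold_sumset 0 X = {0}"
  by (auto simp: hfold_sumset_def)

lemma hfold_sumset_Suc: "hfold_sumset (Suc h) X = hfold_sumset h X + X"
proof (intro Set.set_eqI iffI)
  fix z assume "z \<in> hfold_sumset (Suc h) X"
  then obtain x where "z = (\<Sum>i<h. x i) + x h" "\<forall>i<Suc h. x i \<in> X"
    by (auto simp: hfold_sumset_def)
  then show "z \<in> hfold_sumset h X + X"
    by (auto simp: hfold_sumset_def intro!: set_plus_intro)
next
  fix z assume "z \<in> hfold_sumset h X + X"
  then obtain x y where z: "z = (\<Sum>i<h. x i) + y" "\<forall>i<h. x i \<in> X" "y \<in> X"
    by (auto simp: hfold_sumset_def elim!: set_plus_elim)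
  have "(\<Sum>i<h. x i) = (\<Sum>i<h. (x(h := y)) i)" by (rule sum.cong) auto
  then have "z = (\<Sum>i<Suc h. (x(h := y)) i)" using z by simp
  moreover have "\<forall>i<Suc h. (x(h := y)) i \<in> X" using z by (auto simp: less_Suc_eq)
  ultimately show "z \<in> hfold_sumset (Suc h) X" unfolding hfold_sumset_def by blast
qed

lemma hfold_sumset_1 [simp]: "hfold_sumset (Suc 0) X = X"
  by (simp add: hfold_sumset_Suc)

lemma hfold_sumset_nonempty: "X \<noteq> {} \<Longrightarrow> hfold_sumset h X \<noteq> {}"
  by (induction h) (auto simp: hfold_sumset_Suc set_plus_def)

lemma card_hfold_sumset_mono:
  fixes X :: "'a::{ab_group_add,finite} set"
  assumes "X \<noteq> {}" "g \<le> h"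
  shows "card (hfold_sumset g X) \<le> card (hfold_sumset h X)"
  using assms(2)
proof (induction rule: dec_induct)
  case (step h)
  then show ?case using card_le_card_plus[OF assms(1), of "hfold_sumset h X"]
    by (simp add: hfold_sumset_Suc)
qed simp

lemma sum_free_card_le:
  fixes A :: "'a::{ab_group_add,finite} set"
  assumes "kl_sum_free k l A"
  shows "card (hfold_sumset k A) + card (hfold_sumset l A) \<le> CARD('a)"
proof -
  have "card (hfold_sumset k A \<union> hfold_sumset l A) = card (hfold_sumset k A) + card (hfold_sumset l A)"
    by (rule card_Un_disjoint) (use assms in \<open>auto simp: kl_sum_free_def\<close>)
  then show ?thesis using card_mono[of UNIV "hfold_sumset k A \<union> hfold_sumset l A"] by simp
qed

text \<open>The first copy of \<open>A\<close> contributes \<open>card A\<close> and each later one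
  at least \<open>b\<close>. The partial sumsets stay proper, since adding \<open>A\<close> to the
  whole group gives the whole group.\<close>

lemma card_hfold_sumset_ge:
  fixes A :: "'a::{ab_group_add,finite} set"
  assumes "A \<noteq> {}"
    and b: "\<And>X. X \<noteq> {} \<Longrightarrow> X + A \<noteq> UNIV \<Longrightarrow> b \<le> boundary A X"
    and "hfold_sumset (Suc h) A \<noteq> UNIV"
  shows "int (card A) + int h * b \<le> int (card (hfold_sumset (Suc h) A))"
  using assms(3)
proof (induction h)
  case (Suc h)
  have ne: "hfold_sumset (Suc h) A \<noteq> UNIV"
    using Suc.prems UNIV_plus[OF assms(1)] hfold_sumset_Suc[of "Suc h" A] by metis
  have "b \<le> boundary A (hfold_sumset (Suc h) A)"
    using Suc.prems hfold_sumset_nonempty[OF assms(1)] by (intro b) (auto simp: hfold_sumset_Suc[of "Suc h"])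
  then show ?case using Suc.IH[OF ne]
    by (simp add: boundary_def hfold_sumset_Suc[of "Suc h"] algebra_simps)
qed simp

text \<open>The disjoint nonempty sets \<open>kA\<close> and \<open>lA\<close> are both proper, so
  the growth estimate holds for each with the minimising subgroup, and the two sizes sum to at most
  the group order.\<close>

lemma sum_free_boundary:
  fixes A :: "'a::{ab_group_add,finite} set"
  assumes "kl_sum_free k l A" "l < k" "1 \<le> l"
  obtains H where "add_subgroup H" "H + A \<noteq> UNIV"
    "2 * int (card A) + int (k + l - 2) * boundary A H \<le> int CARD('a)"
proof -
  have ne: "A \<noteq> {}" using assms by (simp add: kl_sum_free_def)
  have card_pos: "0 < card (hfold_sumset h A)" for h
    using hfold_sumset_nonempty[OF ne] by (simp add: card_gt_0_iff)
  have sum_le: "card (hfold_sumset k A) + card (hfold_sumset l A) \<le> CARD('a)"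
    by (rule sum_free_card_le[OF assms(1)])
  have neU: "hfold_sumset k A \<noteq> UNIV" "hfold_sumset l A \<noteq> UNIV"
    using sum_le card_pos[of k] card_pos[of l] by auto
  have "A \<noteq> UNIV"
    using sum_le card_pos[of l] card_hfold_sumset_mono[OF ne, of 1 k] assms(2,3) by auto
  then obtain H where H: "add_subgroup H" "H + A \<noteq> UNIV"
    "\<And>X. X \<noteq> {} \<Longrightarrow> X + A \<noteq> UNIV \<Longrightarrow> boundary A H \<le> boundary A X"
    by (rule subgroup_minimizes_boundary) blast
  have ge: "int (card A) + int (h - 1) * boundary A H \<le> int (card (hfold_sumset h A))"
    if "1 \<le> h" "hfold_sumset h A \<noteq> UNIV" for h
    using card_hfold_sumset_ge[OF ne H(3), of "h - 1"] that by simp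
  have "2 * int (card A) + (int (k - 1) + int (l - 1)) * boundary A H \<le> int CARD('a)"
    using ge[of k] ge[of l] neU sum_le assms(2,3) by (simp add: algebra_simps)
  moreover have "int (k - 1) + int (l - 1) = int (k + l - 2)" using assms by linarith
  ultimately show thesis using that H(1,2) by metis
qed

lemma sum_free_arith_prog:
  fixes S :: "'p::prime_card mod_ring set"
  assumes "kl_sum_free k l S" "l < k" "1 \<le> l" "card S = m + 1" "1 \<le> m"
    and p: "CARD('p) < (k + l) * (m + 1)"
  shows "is_arith_prog S"
proof (rule ccontr)
  assume nap: "\<not> is_arith_prog S"
  have ne: "S \<noteq> {}" using assms by auto
  have sum_le: "card (hfold_sumset k S) + card (hfold_sumset l S) \<le> CARD('p)"
    using sum_free_card_le[OF assms(1)] by simp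
  have "2 \<le> card (hfold_sumset l S)" using card_hfold_sumset_mono[OF ne assms(3)] assms(4,5) by simp
  \<comment> \<open>The two points outside the sumset required by Vosper's theorem come from the
    disjoint set \<open>lS\<close>, of size at least \<open>m + 1 \<ge> 2\<close>.\<close>
  then have le: "card (hfold_sumset h S) + 2 \<le> CARD('p)" if "h \<le> k" for h
    using sum_le card_hfold_sumset_mono[OF ne that] by linarith
  have big: "Suc h * (m + 1) \<le> card (hfold_sumset (Suc h) S)" if "Suc h \<le> k" for h
    using that
  proof (induction h)
    case (Suc h)
    let ?X = "hfold_sumset (Suc h) S"
    have "card ?X + card S \<le> card (?X + S)"
    proof (rule vosper[OF _ _ _ nap])
      show "2 \<le> card ?X" using card_hfold_sumset_mono[OF ne, of 1 "Suc h"] assms(4,5) by simp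
      show "card (?X + S) + 2 \<le> CARD('p)" using le[OF Suc.prems] by (simp add: hfold_sumset_Suc[of "Suc h"])
    qed (use assms in simp)
    then show ?case using Suc assms(4) by (simp add: hfold_sumset_Suc[of "Suc h"])
  qed (use assms in simp)
  have "k * (m + 1) + l * (m + 1) \<le> CARD('p)"
    using big[of "k - 1"] big[of "l - 1"] sum_le assms(2,3) by simp
  then show False using p by (simp add: algebra_simps)
qed

section \<open>Large sum-free sets are unions of hyperplane cosets\<close>

text \<open>The numerical core, with \<open>K = k + l - 2\<close>, \<open>P\<close> the size of a
  hyperplane, and \<open>a\<close>, \<open>hA\<close>, \<open>h\<close> the sizes of
  \<open>A\<close>, \<open>H + A\<close>, \<open>H\<close>. A subgroup smaller than a hyperplane
  leaves too large a boundary; for a hyperplane, \<open>s\<close> counts the cosets met by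
  \<open>A\<close>.\<close>

lemma large_sum_free_arith:
  fixes K m lam p P a hA h :: nat
  assumes K: "lam < K" and p: "p = (K + 2) * m + 2 + lam" and P: "0 < P"
    and m: "1 \<le> m"
    and a: "(m + 1) * P \<le> a" "a \<le> hA"
    and bound: "2 * int a + int K * (int hA - int h) \<le> int (p * P)"
    and h: "h = P \<and> P dvd hA \<or> h * p \<le> P"
  shows "h = P \<and> hA \<le> (m + 1) * P"
proof -
  have "\<not> h * p \<le> P"
  proof
    assume hp: "h * p \<le> P"
    have "int (K + 2) * int a \<le> int (p * P) + int K * int h"
      using bound mult_left_mono[of "int a" "int hA" "int K"] a(2) by (simp add: algebra_simps)
    then have "(K + 2) * a \<le> p * P + K * h"
      by (metis of_nat_add of_nat_le_iff of_nat_mult)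
    then have "((K + 2) * a) * p \<le> (p * P + K * h) * p" by (rule mult_le_mono1)
    also have "\<dots> = p * p * P + K * (h * p)" by (simp add: algebra_simps)
    also have "\<dots> \<le> p * p * P + K * P" using hp by simp
    finally have "((K + 2) * a) * p \<le> (p * p + K) * P" by (simp add: algebra_simps)
    moreover have "((K + 2) * ((m + 1) * P)) * p \<le> ((K + 2) * a) * p"
      using a(1) by (intro mult_le_mono) auto
    ultimately have "((K + 2) * (m + 1) * p) * P \<le> (p * p + K) * P" by (simp add: algebra_simps)
    then have "(K + 2) * (m + 1) * p \<le> p * p + K" using P by simp
    \<comment> \<open>This is where \<open>lam < K\<close> enters; it turns the previous estimate
      into \<open>p \<le> K\<close>, which is absurd for \<open>m \<ge> 1\<close>.\<close>
    moreover have "p + 1 \<le> (K + 2) * (m + 1)" using K p by simp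
    then have "(p + 1) * p \<le> (K + 2) * (m + 1) * p" by (rule mult_le_mono1)
    ultimately have "p \<le> K" by (simp add: algebra_simps)
    moreover have "K + 2 \<le> (K + 2) * m" using m by (cases m) auto
    ultimately show False using p by linarith
  qed
  then have hP: "h = P" "P dvd hA" using h by auto
  then obtain s where s: "hA = P * s" by auto
  have "2 * (int (m + 1) * int P) + int K * (int P * int s - int P) \<le> int p * int P"
  proof -
    have "int (m + 1) * int P \<le> int a" using a(1) by (metis of_nat_le_iff of_nat_mult)
    then show ?thesis using bound hP(1) s by simp
  qed
  then have "(2 * int (m + 1) + int K * (int s - 1)) * int P \<le> int p * int P"
    by (simp add: algebra_simps)
  then have "2 * int (m + 1) + int K * (int s - 1) \<le> int p" using P by simp
  then have "int K * (int s - 1) \<le> int K * int m + int lam" using p by (simp add: algebra_simps)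
  then have "int K * (int s - 1 - int m) < int K * 1" using K by (simp add: algebra_simps)
  then have "int s - 1 - int m < 1" using K by (subst (asm) mult_less_cancel_left_pos) auto
  then have "s \<le> m + 1" by linarith
  then show ?thesis using hP s mult_le_mono2[of s "m + 1" P] by (simp add: mult.commute)
qed

text \<open>The order of \<open>H\<close> is a power of the characteristic, so \<open>H\<close> is a
  hyperplane or smaller by at least that factor. The arithmetic gives
  \<open>card (H + A) \<le> card A\<close>, hence \<open>H + A = A\<close>. Assuming only a lower
  bound on \<open>card A\<close> lets the lemma serve the upper bound as well as the
  classification.\<close>

lemma large_sum_free_periodic:
  fixes A :: "('p::prime_card mod_ring ^ 'n::finite) set"
  assumes sf: "kl_sum_free k l A" and kl: "l < k" "1 \<le> l" and m: "1 \<le> m"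
    and lam: "lam + 3 \<le> k + l" and p: "CARD('p) = (k + l) * m + 2 + lam"
    and large: "(m + 1) * CARD('p) ^ (CARD('n) - 1) \<le> card A"
  obtains H where "add_subgroup H" "card H = CARD('p) ^ (CARD('n) - 1)" "H + A = A"
    "card A = (m + 1) * CARD('p) ^ (CARD('n) - 1)"
proof -
  define P where "P = CARD('p) ^ (CARD('n) - 1)"
  have prime: "prime CARD('p)" by (rule prime_card)
  have Ppos: "0 < P" unfolding P_def by simp
  have pP: "CARD('p) * P = CARD('p) ^ CARD('n)"
    unfolding P_def by (simp add: power_eq_if)
  obtain H where H: "add_subgroup H" "H + A \<noteq> UNIV"
    "2 * int (card A) + int (k + l - 2) * boundary A H \<le> int CARD('p mod_ring ^ 'n)"
    by (rule sum_free_boundary[OF sf kl])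
  have ne: "A \<noteq> {}" using sf by (simp add: kl_sum_free_def)
  have "card H dvd CARD('p) ^ CARD('n)" using add_subgroup_card_dvd[OF H(1)] by simp
  then obtain t where t: "t \<le> CARD('n)" "card H = CARD('p) ^ t"
    using divides_primepow_nat[OF prime] by blast
  have "H \<noteq> UNIV" using H(2) UNIV_plus[OF ne] by blast
  then have "card H \<noteq> CARD('p) ^ CARD('n)" using card_eq_UNIV_imp_eq_UNIV[of H] by auto
  then have "t \<noteq> CARD('n)" using t by auto
  then have t': "t \<le> CARD('n) - 1" using t by linarith
  have alt: "card H = P \<and> P dvd card (H + A) \<or> card H * CARD('p) \<le> P"
  proof (cases "t = CARD('n) - 1")
    case True
    then show ?thesis using t add_subgroup_card_dvd_plus[OF H(1), of A] by (simp add: P_def)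
  next
    case False
    then have "Suc t \<le> CARD('n) - 1" using t' by simp
    then have "CARD('p) ^ Suc t \<le> P" unfolding P_def by (intro power_increasing) (auto simp: Suc_leI)
    then show ?thesis using t by (simp add: mult.commute)
  qed
  have sub: "A \<subseteq> H + A" using H(1) by (intro set_zero_plus2) (simp add: add_subgroup_def)
  then have le: "card A \<le> card (H + A)" by (intro card_mono) auto
  have bd: "2 * int (card A) + int (k + l - 2) * (int (card (H + A)) - int (card H)) \<le> int (CARD('p) * P)"
    using H(3) by (simp add: boundary_def pP del: of_nat_mult of_nat_power)
  have "card H = P \<and> card (H + A) \<le> (m + 1) * P"
  proof (rule large_sum_free_arith[OF _ _ Ppos m _ le bd alt])
    show "lam < k + l - 2" using lam by linarith
    show "CARD('p) = (k + l - 2 + 2) * m + 2 + lam" using p lam by (simp only: le_add_diff_inverse2)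
    show "(m + 1) * P \<le> card A" using large by (simp add: P_def)
  qed
  then have c: "card H = P" "card A = (m + 1) * P" "card (H + A) = card A" using le large by (auto simp: P_def)
  then have "H + A = A" using card_subset_eq[OF _ sub] by simp
  then show thesis using that H(1) c by (simp add: P_def)
qed

section \<open>Hyperplanes, cylinders and isomorphisms\<close>

text \<open>Every scalar of the prime field is a sum of ones, so additivity already gives
  linearity.\<close>

lemma additive_mod_ring_scale:
  fixes f :: "'p::prime_card mod_ring ^ 'n \<Rightarrow> 'p mod_ring ^ 'm"
  assumes "\<And>x y. f (x + y) = f x + f y"
  shows "f (a *s x) = a *s f x"
proof -
  have f0: "f 0 = 0" using assms[of 0 0] by simp
  obtain i where "a = of_nat i" using surj_of_nat_mod_ring by blast
  moreover have "f (of_nat i *s x) = of_nat i *s f x"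
  proof (induction i)
    case (Suc i)
    then show ?case by (simp add: assms vector_sadd_rdistrib)
  qed (simp add: f0)
  ultimately show ?thesis by simp
qed

lemma add_subgroup_subspace:
  fixes H :: "('p::prime_card mod_ring ^ 'n) set"
  assumes "add_subgroup H"
  shows "vec.subspace H"
proof (rule vec.subspaceI)
  show "0 \<in> H" using assms by (simp add: add_subgroup_def)
  show "x + y \<in> H" if "x \<in> H" "y \<in> H" for x y using add_subgroup_add[OF assms that] .
  fix a :: "'p mod_ring" and x assume x: "x \<in> H"
  obtain i where "a = of_nat i" using surj_of_nat_mod_ring by blast
  moreover have "of_nat i *s x \<in> H"
    by (induction i) (use x assms in \<open>auto simp: vector_sadd_rdistrib add_subgroup_add add_subgroup_def[of H]\<close>)
  ultimately show "a *s x \<in> H" by simp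
qed

text \<open>A basis of \<open>H\<close> is extended by a vector \<open>w\<close> outside
  \<open>H\<close>; a linear map killing the basis but not \<open>w\<close> vanishes on
  \<open>H\<close>.\<close>

lemma proper_subspace_functional:
  fixes H :: "('a::field ^ 'n) set"
  assumes "vec.subspace H" "H \<noteq> UNIV"
  obtains u :: "'a ^ 'n" where "u \<noteq> 0" "\<And>x. x \<in> H \<Longrightarrow> (\<Sum>i\<in>UNIV. u $ i * x $ i) = 0"
proof -
  obtain B where B: "B \<subseteq> H" "vec.independent B" "H \<subseteq> vec.span B"
    using vec.maximal_independent_subset by blast
  have "vec.span B \<subseteq> H" using B(1) assms(1) by (rule vec.span_minimal)
  then obtain w where w: "w \<notin> vec.span B" using assms(2) by blast
  then have ind: "vec.independent (insert w B)" using B(2) by (simp add: vec.independent_insert)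
  \<comment> \<open>The map \<open>g\<close> takes vector values; its coordinate
    \<open>undefined\<close>, an arbitrary fixed index, is the functional, and \<open>u\<close>
    collects its coefficients.\<close>
  obtain g where g: "Vector_Spaces.linear (*s) (*s) g"
    "\<forall>x\<in>insert w B. g x = (if x = w then axis undefined 1 else 0 :: 'a ^ 'n)"
    using vec.linear_independent_extend[OF ind, of "\<lambda>x. if x = w then axis undefined 1 else 0"] by blast
  define u :: "'a ^ 'n" where "u = (\<chi> i. g (axis i 1) $ undefined)"
  interpret g: Vector_Spaces.linear "(*s)" "(*s)" g by (rule g(1))
  have gu: "g x $ undefined = (\<Sum>i\<in>UNIV. u $ i * x $ i)" for x
  proof -
    have "g x = g (\<Sum>i\<in>UNIV. x $ i *s axis i 1)" by (simp add: basis_expansion)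
    also have "\<dots> = (\<Sum>i\<in>UNIV. x $ i *s g (axis i 1))" by (simp add: g.sum g.scale)
    finally show ?thesis by (simp add: u_def mult.commute)
  qed
  have "g w $ undefined = 1" using g(2) by (simp add: axis_def)
  then have "u \<noteq> 0" using gu[of w] by auto
  moreover have "(\<Sum>i\<in>UNIV. u $ i * x $ i) = 0" if "x \<in> H" for x
  proof -
    have "g x = 0"
    proof (rule g.eq_0_on_span)
      show "x \<in> vec.span B" using that B(3) by blast
      show "g b = 0" if "b \<in> B" for b using g(2) that w vec.span_base[of b B] by auto
    qed
    then show ?thesis using gu[of x] by simp
  qed
  ultimately show thesis by (rule that)
qed

section \<open>Cylinders over subsets of one coordinate\<close>

definition cylinder :: "'n \<Rightarrow> 'a set \<Rightarrow> ('a ^ 'n) set" where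
  "cylinder c S = {x. x $ c \<in> S}"

lemma card_cylinder:
  fixes S :: "'a::{ab_group_add,finite} set" and c :: "'n::finite"
  shows "card (cylinder c S) = card S * CARD('a) ^ (CARD('n) - 1)"
proof -
  define N where "N = card (cylinder c {0 :: 'a})"
  have fib: "card (cylinder c {s}) = N" for s :: 'a
  proof -
    have "cylinder c {s} = {axis c s} + cylinder c {0}"
      by (auto simp: mem_sing_plus cylinder_def axis_def)
    then show ?thesis by (simp add: card_sing_plus N_def)
  qed
  have sum: "card (cylinder c T) = card T * N" for T :: "'a set"
  proof -
    have "cylinder c T = (\<Union>s\<in>T. cylinder c {s})" by (auto simp: cylinder_def)
    also have "card \<dots> = (\<Sum>s\<in>T. card (cylinder c {s}))"
      by (rule card_UN_disjoint) (auto simp: cylinder_def)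
    finally show ?thesis by (simp add: fib)
  qed
  \<comment> \<open>The common fibre size \<open>N\<close> is found from the cylinder over
    everything, which is the full space.\<close>
  have "CARD('a) * N = CARD('a) * CARD('a) ^ (CARD('n) - 1)"
    using sum[of UNIV] by (simp add: cylinder_def power_eq_if)
  then have "N = CARD('a) ^ (CARD('n) - 1)" by simp
  then show ?thesis by (simp add: sum)
qed

lemma additive_automorphism_coordinate:
  fixes u :: "'a::{field,finite} ^ 'n" and c :: 'n
  assumes "u \<noteq> 0"
  obtains f :: "'a ^ 'n \<Rightarrow> 'a ^ 'n" where "bij f" "\<And>x y. f (x + y) = f x + f y"
    "\<And>x. f x $ c = (\<Sum>i\<in>UNIV. u $ i * x $ i)"
proof -
  obtain r where r: "u $ r \<noteq> 0" using assms by (auto simp: vec_eq_iff)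
  \<comment> \<open>The functional replaces coordinate \<open>c\<close>, and the displaced old
    coordinate moves to place \<open>r\<close>. Nothing is lost: as \<open>u $ r \<noteq> 0\<close>,
    the entry \<open>x $ r\<close> is recovered from the functional.\<close>
  define f :: "'a ^ 'n \<Rightarrow> 'a ^ 'n" where
    "f x = (\<chi> i. if i = c then \<Sum>i\<in>UNIV. u $ i * x $ i else if i = r then x $ c else x $ i)" for x
  have add: "f (x + y) = f x + f y" for x y
    by (simp add: f_def vec_eq_iff algebra_simps sum.distrib)
  have zero: "x = 0" if "f x = 0" for x
  proof -
    have fi: "f x $ i = 0" for i using that by simp
    have off: "x $ i = 0" if "i \<noteq> r" for i
    proof (cases "i = c")
      case True
      then show ?thesis using fi[of r] that by (simp add: f_def)
    next
      case False
      then show ?thesis using fi[of i] that by (simp add: f_def)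
    qed
    have "(\<Sum>i\<in>UNIV. u $ i * x $ i) = (\<Sum>i\<in>{r}. u $ i * x $ i)"
      by (rule sum.mono_neutral_right) (auto simp: off)
    then have "x $ r = 0" using fi[of c] r by (simp add: f_def)
    then show ?thesis using off by (metis vec_eq_iff zero_index)
  qed
  have "inj f"
  proof (rule injI)
    fix x y assume "f x = f y"
    then have "f (x - y) = 0" using add[of "x - y" y] by simp
    then show "x = y" using zero by fastforce
  qed
  then have "bij f" by (simp add: bij_def finite_UNIV_inj_surj)
  then show thesis using that add by (simp add: f_def)
qed

section \<open>Isomorphism of sets and its invariants\<close>

lemma set_isomorphicI:
  assumes "bij f" "\<And>x y. f (x + y) = f x + f y" "f ` A = B"
  shows "set_isomorphic A B"
  using assms unfolding set_isomorphic_def by blast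

lemma set_isomorphic_refl: "set_isomorphic A A"
  by (rule set_isomorphicI[of id]) auto

lemma set_isomorphic_sym:
  assumes "set_isomorphic A B"
  shows "set_isomorphic B A"
proof -
  obtain f where f: "bij f" "\<And>x y. f (x + y) = f x + f y" "f ` A = B"
    using assms unfolding set_isomorphic_def by blast
  let ?g = "inv_into UNIV f"
  show ?thesis
  proof (rule set_isomorphicI[of ?g])
    show "bij ?g" using f(1) by (rule bij_imp_bij_inv)
    show "?g (x + y) = ?g x + ?g y" for x y
      using f(2)[of "?g x" "?g y"] f(1) by (metis bij_inv_eq_iff)
    show "?g ` B = A" using f(1,3) by (metis bij_is_inj image_inv_f_f)
  qed
qed

lemma set_isomorphic_trans:
  assumes "set_isomorphic A B" "set_isomorphic B C"
  shows "set_isomorphic A C"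
proof -
  obtain f where f: "bij f" "\<And>x y. f (x + y) = f x + f y" "f ` A = B"
    using assms unfolding set_isomorphic_def by blast
  obtain g where g: "bij g" "\<And>x y. g (x + y) = g x + g y" "g ` B = C"
    using assms unfolding set_isomorphic_def by blast
  show ?thesis
    by (rule set_isomorphicI[of "g \<circ> f"]) (use f g in \<open>auto simp: image_comp[symmetric] intro: bij_comp\<close>)
qed

lemma equiv_set_isomorphic: "equiv UNIV {(A, B). set_isomorphic A B}"
  by (rule equivI)
    (auto simp: refl_on_def sym_def trans_def
      intro: set_isomorphic_refl set_isomorphic_sym set_isomorphic_trans)

lemma hfold_sumset_image:
  fixes f :: "'a::ab_group_add \<Rightarrow> 'b::ab_group_add"
  assumes "\<And>x y. f (x + y) = f x + f y"
  shows "hfold_sumset h (f ` A) = f ` hfold_sumset h A"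
proof (induction h)
  case 0
  have "f 0 = 0" using assms[of 0 0] by simp
  then show ?case by simp
next
  case (Suc h)
  have "f ` X + f ` A = f ` (X + A)" for X by (auto simp: set_plus_def assms[symmetric] image_iff)
  then show ?case by (simp add: hfold_sumset_Suc Suc)
qed

lemma kl_sum_free_isomorphic:
  assumes "set_isomorphic A B" "kl_sum_free k l A"
  shows "kl_sum_free k l B"
proof -
  obtain f where f: "bij f" "\<And>x y. f (x + y) = f x + f y" "f ` A = B"
    using assms unfolding set_isomorphic_def by blast
  have "f ` hfold_sumset k A \<inter> f ` hfold_sumset l A = {}"
    using assms(2) bij_is_inj[OF f(1)] by (auto simp: kl_sum_free_def inj_eq)
  then show ?thesis using assms(2) f(3) hfold_sumset_image[OF f(2)] by (auto simp: kl_sum_free_def)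
qed

lemma card_isomorphic:
  assumes "set_isomorphic A B"
  shows "card A = card B"
  using assms unfolding set_isomorphic_def
  by (metis bij_is_inj card_image inj_on_subset subset_UNIV)

text \<open>The projection to coordinate \<open>c\<close> and the embedding \<open>axis c\<close>
  carry a common element of the two sumsets from either side to the other.\<close>

lemma kl_sum_free_cylinder:
  fixes S :: "'a::ab_group_add set" and c :: "'n::finite"
  shows "kl_sum_free k l (cylinder c S) \<longleftrightarrow> kl_sum_free k l S"
proof -
  have ax: "axis c s \<in> cylinder c S \<longleftrightarrow> s \<in> S" for s by (simp add: cylinder_def axis_def)
  have im: "(\<lambda>x. x $ c) ` cylinder c S = S"
    using ax by (auto simp: cylinder_def image_iff) (metis axis_nth)
  have down: "(\<lambda>x. x $ c) ` hfold_sumset h (cylinder c S) = hfold_sumset h S" for h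
    using hfold_sumset_image[of "\<lambda>x. x $ c" h "cylinder c S"] im by simp
  have axadd: "axis c (x + y) = axis c x + axis c y" for x y :: 'a
    by (simp add: vec_eq_iff axis_def)
  have mono: "hfold_sumset h X \<subseteq> hfold_sumset h Y" if "X \<subseteq> Y" for h and X Y :: "('a ^ 'n) set"
    using that unfolding hfold_sumset_def by blast
  have "axis c ` hfold_sumset h S = hfold_sumset h (axis c ` S)" for h
    by (rule hfold_sumset_image[symmetric]) (rule axadd)
  also have "\<dots> h \<subseteq> hfold_sumset h (cylinder c S)" for h
    by (rule mono) (use ax in auto)
  finally have up: "axis c ` hfold_sumset h S \<subseteq> hfold_sumset h (cylinder c S)" for h .
  have "cylinder c S = {} \<longleftrightarrow> S = {}" using im by blast
  moreover have "hfold_sumset k (cylinder c S) \<inter> hfold_sumset l (cylinder c S) = {}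
      \<longleftrightarrow> hfold_sumset k S \<inter> hfold_sumset l S = {}"
    using down[of k] down[of l] up[of k] up[of l] by blast
  ultimately show ?thesis by (simp add: kl_sum_free_def)
qed

lemma cylinder_scale_isomorphic:
  fixes S :: "'a::field set" and c :: "'n::finite"
  assumes "t \<noteq> 0"
  shows "set_isomorphic (cylinder c S) (cylinder c ((*) t ` S))"
proof (rule set_isomorphicI[of "(*s) t"])
  show "bij ((*s) t :: 'a ^ 'n \<Rightarrow> _)"
    by (rule bij_betw_byWitness[of _ "(*s) (inverse t)"]) (use assms in auto)
  show "t *s (x + y) = t *s x + t *s y" for x y :: "'a ^ 'n" by (simp add: vector_add_ldistrib)
  show "(*s) t ` cylinder c S = cylinder c ((*) t ` S)"
  proof (intro Set.equalityI subsetI)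
    fix y assume "y \<in> cylinder c ((*) t ` S)"
    then have "inverse t *s y \<in> cylinder c S" using assms
      by (auto simp: cylinder_def mult.assoc[symmetric])
    moreover have "y = t *s (inverse t *s y)" using assms by simp
    ultimately show "y \<in> (*s) t ` cylinder c S" by blast
  qed (auto simp: cylinder_def)
qed

text \<open>An automorphism turns a functional vanishing on \<open>H\<close> into coordinate
  \<open>c\<close>. By counting, \<open>H\<close> becomes the whole kernel of that coordinate, so a
  union of its cosets becomes a cylinder.\<close>

lemma large_sum_free_cylinder:
  fixes A :: "('p::prime_card mod_ring ^ 'n::finite) set" and c :: 'n
  assumes "add_subgroup H" "card H = CARD('p) ^ (CARD('n) - 1)" "H + A = A"
  obtains S where "set_isomorphic A (cylinder c S)"
proof -
  have "CARD('p) ^ (CARD('n) - 1) < CARD('p) ^ CARD('n)"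
    using prime_gt_1_nat[OF prime_card[where 'a='p]] by (intro power_strict_increasing) auto
  then have "H \<noteq> UNIV" using assms(2) by auto
  then obtain u :: "'p mod_ring ^ 'n" where u: "u \<noteq> 0"
    "\<And>x. x \<in> H \<Longrightarrow> (\<Sum>i\<in>UNIV. u $ i * x $ i) = 0"
    using proper_subspace_functional[OF add_subgroup_subspace[OF assms(1)]] by metis
  obtain f :: "'p mod_ring ^ 'n \<Rightarrow> 'p mod_ring ^ 'n" where f: "bij f"
    "\<And>x y. f (x + y) = f x + f y" "\<And>x. f x $ c = (\<Sum>i\<in>UNIV. u $ i * x $ i)"
    by (rule additive_automorphism_coordinate[OF u(1), of c]) blast
  have "f ` H \<subseteq> cylinder c {0}" using f(3) u(2) by (auto simp: cylinder_def)
  moreover have "card (f ` H) = card H"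
    using bij_is_inj[OF f(1)] by (metis card_image inj_on_subset subset_UNIV)
  ultimately have fH: "f ` H = cylinder c {0}"
    using assms(2) by (intro card_subset_eq) (simp_all add: card_cylinder)
  have "f ` A = cylinder c ((\<lambda>x. x $ c) ` f ` A)"
  proof (intro Set.equalityI subsetI)
    fix y assume "y \<in> cylinder c ((\<lambda>x. x $ c) ` f ` A)"
    then obtain a where a: "a \<in> A" "y $ c = f a $ c" by (auto simp: cylinder_def)
    then have "y - f a \<in> f ` H" unfolding fH by (simp add: cylinder_def)
    then obtain h where h: "h \<in> H" "y - f a = f h" by blast
    then have "y = f (h + a)" using f(2)[of h a] by (metis diff_add_cancel)
    moreover have "h + a \<in> A" using assms(3) a(1) h(1) set_plus_intro by metis
    ultimately show "y \<in> f ` A" by blast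
  qed (auto simp: cylinder_def)
  then show thesis using that set_isomorphicI[OF f(1,2)] by metis
qed

section \<open>Intervals\<close>

text \<open>Given by start and length rather than by endpoints, so that sumsets just add the
  parameters even when they wrap around.\<close>

definition arc :: "'p::prime_card mod_ring \<Rightarrow> nat \<Rightarrow> 'p mod_ring set" where
  "arc a m = (\<lambda>i. a + of_nat i) ` {..m}"

lemma card_arc: "m < CARD('p) \<Longrightarrow> card (arc a m :: 'p::prime_card mod_ring set) = m + 1"
  unfolding arc_def by (subst card_image) (auto simp: inj_on_def of_nat_mod_ring_eq_iff)

lemma cyc_interval_eq_arc:
  fixes a :: "'p::prime_card mod_ring"
  assumes "m < CARD('p)"
  shows "cyc_interval a (a + of_nat m) = arc a m"
proof -
  have "(LEAST d. a + of_nat d = a + of_nat m) = m"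
  proof (rule Least_equality)
    fix d assume "a + of_nat d = a + of_nat m"
    then show "m \<le> d" using of_nat_mod_ring_eq_iff[of d m, where 'p='p] assms by fastforce
  qed simp
  then show ?thesis by (auto simp: cyc_interval_def arc_def)
qed

lemma extremal_set_eq:
  assumes "m < CARD('p::prime_card)"
  shows "(extremal_set c k l m j :: ('p mod_ring ^ 'n) set) = cylinder c (arc (extremal_start k l m j) m)"
  by (simp add: extremal_set_def cylinder_def cyc_interval_eq_arc[OF assms])

lemma arc_plus_arc: "arc a m + arc b n = arc (a + b) (m + n)"
proof (intro Set.equalityI subsetI)
  fix x assume "x \<in> arc (a + b) (m + n)"
  then obtain i where i: "i \<le> m + n" "x = a + b + of_nat i" by (auto simp: arc_def)
  define i' where "i' = min i m"
  have "x = (a + of_nat i') + (b + of_nat (i - i'))"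
    using i by (simp add: i'_def algebra_simps flip: of_nat_add)
  moreover have "i' \<le> m" "i - i' \<le> n" using i(1) by (auto simp: i'_def)
  then have "a + of_nat i' \<in> arc a m" "b + of_nat (i - i') \<in> arc b n"
    unfolding arc_def by blast+
  ultimately show "x \<in> arc a m + arc b n" by blast
next
  fix x assume "x \<in> arc a m + arc b n"
  then obtain i j where "i \<le> m" "j \<le> n" "x = (a + of_nat i) + (b + of_nat j)"
    by (auto simp: arc_def elim!: set_plus_elim)
  then have "i + j \<le> m + n" "x = a + b + of_nat (i + j)" by (auto simp: algebra_simps)
  then show "x \<in> arc (a + b) (m + n)" unfolding arc_def by blast
qed

lemma hfold_sumset_arc: "hfold_sumset h (arc a m) = arc (of_nat h * a) (h * m)"
proof (induction h)
  case 0
  then show ?case by (simp add: arc_def)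
next
  case (Suc h)
  then show ?case by (simp add: hfold_sumset_Suc arc_plus_arc algebra_simps)
qed

text \<open>The arc \<open>kA\<close> starts at \<open>k a\<close>, and \<open>lA\<close> starts
  \<open>w = k * m + 1 + j\<close> steps later. So \<open>lA\<close> starts just after the end of
  \<open>kA\<close> with a gap of \<open>j\<close> points, and it ends before \<open>k a\<close>
  recurs exactly when \<open>j \<le> lam\<close>.\<close>

lemma arc_sum_free_iff:
  fixes a :: "'p::prime_card mod_ring"
  assumes p: "CARD('p) = (k + l) * m + 2 + lam"
  shows "kl_sum_free k l (arc a m) \<longleftrightarrow>
    (\<exists>j\<le>lam. (of_nat k - of_nat l) * a = - of_nat (k * m + 1 + j))"
proof
  assume sf: "kl_sum_free k l (arc a m)"
  obtain j where j: "j < CARD('p)" "- ((of_nat k - of_nat l) * a) - of_nat (k * m + 1) = of_nat j"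
    using surj_of_nat_mod_ring by blast
  then have eq: "(of_nat k - of_nat l) * a = - of_nat (k * m + 1 + j)"
    by (simp add: algebra_simps)
  have no: False if "u \<le> k * m" "v \<le> l * m" "of_nat k * a + of_nat u = of_nat l * a + of_nat v" for u v
  proof -
    have "of_nat k * a + of_nat u \<in> hfold_sumset k (arc a m)"
      "of_nat l * a + of_nat v \<in> hfold_sumset l (arc a m)"
      unfolding hfold_sumset_arc using that(1,2) by (auto simp: arc_def)
    then show False using sf that(3) by (auto simp: kl_sum_free_def)
  qed
  have "j \<le> lam"
  proof (rule ccontr)
    assume "\<not> j \<le> lam"
    define w where "w = k * m + 1 + j"
    have kla: "of_nat k * a + of_nat w = of_nat l * a" using eq unfolding w_def by (simp add: algebra_simps)
    show False
    \<comment> \<open>If \<open>w\<close> passes a full turn, the start of \<open>lA\<close> lies in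
      \<open>kA\<close>; otherwise the start of \<open>kA\<close> lies in \<open>lA\<close>.\<close>
    proof (cases "CARD('p) \<le> w")
      case True
      have "(of_nat (w - CARD('p)) :: 'p mod_ring) = of_nat w" using True by (simp add: of_nat_diff)
      then have "of_nat k * a + of_nat (w - CARD('p)) = of_nat l * a + of_nat 0" using kla by simp
      moreover have "w - CARD('p) \<le> k * m" using j(1) by (simp add: w_def)
      ultimately show False using no[of "w - CARD('p)" 0] by blast
    next
      case False
      have "(of_nat (CARD('p) - w) :: 'p mod_ring) = - of_nat w" using False by (simp add: of_nat_diff)
      then have "of_nat k * a + of_nat 0 = of_nat l * a + of_nat (CARD('p) - w)"
        using kla by (simp add: algebra_simps)
      moreover have "CARD('p) - w \<le> l * m"
        using p \<open>\<not> j \<le> lam\<close> unfolding w_def by (simp add: algebra_simps)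
      ultimately show False using no[of 0 "CARD('p) - w"] by blast
    qed
  qed
  then show "\<exists>j\<le>lam. (of_nat k - of_nat l) * a = - of_nat (k * m + 1 + j)" using eq by blast
next
  assume "\<exists>j\<le>lam. (of_nat k - of_nat l) * a = - of_nat (k * m + 1 + j)"
  then obtain j where j: "j \<le> lam" "(of_nat k - of_nat l) * a = - of_nat (k * m + 1 + j)" by blast
  have "False" if uv: "u \<le> k * m" "v \<le> l * m" "of_nat k * a + of_nat u = of_nat l * a + of_nat v" for u v
  proof -
    \<comment> \<open>A common point would make \<open>w\<close> vanish in the field, although
      \<open>w\<close> lies strictly between \<open>0\<close> and the field order.\<close>
    define w where "w = (k * m - u) + 1 + j + v"
    have "k * m + 1 + j + v = w + u" using uv(1) by (simp add: w_def)
    then have "of_nat (k * m + 1 + j) + of_nat v = (of_nat w + of_nat u :: 'p mod_ring)"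
      by (metis of_nat_add)
    moreover have "of_nat (k * m + 1 + j) + of_nat v = (of_nat u :: 'p mod_ring)"
    proof -
      have w: "of_nat (k * m + 1 + j) = - ((of_nat k - of_nat l) * a)" by (simp only: j(2) minus_minus)
      have v: "of_nat v = of_nat k * a + of_nat u - of_nat l * a" using uv(3) by (simp add: algebra_simps)
      show ?thesis unfolding w v by (simp add: algebra_simps)
    qed
    ultimately have "(of_nat w :: 'p mod_ring) = of_nat 0" by simp
    moreover have "w < CARD('p)" using p uv j(1) by (simp add: w_def algebra_simps)
    ultimately have "w = 0" using of_nat_mod_ring_eq_iff[of w 0, where 'p='p] by simp
    then show False by (simp add: w_def)
  qed
  then have "arc (of_nat k * a) (k * m) \<inter> arc (of_nat l * a) (l * m) = {}"
    unfolding arc_def by (auto simp: disjoint_iff)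
  then show "kl_sum_free k l (arc a m)"
    unfolding kl_sum_free_def hfold_sumset_arc by (simp add: arc_def)
qed

lemma extremal_start_iff:
  assumes "l < k" "k - l < CARD('p)"
  shows "a = extremal_start k l m j \<longleftrightarrow>
    (of_nat k - of_nat l) * a = - (of_nat (k * m + 1 + j) :: 'p::prime_card mod_ring)"
proof -
  have "(of_nat (k - l) :: 'p mod_ring) \<noteq> 0"
    using of_nat_mod_ring_eq_iff[of "k - l" 0, where 'p='p] assms by simp
  then have nz: "(of_nat k - of_nat l :: 'p mod_ring) \<noteq> 0" using assms(1) by (simp add: of_nat_diff)
  define D where "D = (of_nat k - of_nat l :: 'p mod_ring)"
  define E where "E = (of_nat (k * m + 1 + j) :: 'p mod_ring)"
  have "D \<noteq> 0" using nz by (simp add: D_def)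
  then have "a = - E * inverse D \<longleftrightarrow> D * a = - E" by (auto simp: field_simps)
  then show ?thesis by (simp only: extremal_start_def D_def E_def)
qed

lemma uminus_arc: "uminus ` arc a m = arc (- a - of_nat m) m"
proof (intro Set.equalityI subsetI)
  fix x assume "x \<in> uminus ` arc a m"
  then obtain i where i: "i \<le> m" "x = - (a + of_nat i)" by (auto simp: arc_def)
  then have "x = - a - of_nat m + of_nat (m - i)" by (simp add: of_nat_diff)
  then show "x \<in> arc (- a - of_nat m) m" unfolding arc_def by (metis atMost_iff diff_le_self imageI)
next
  fix x assume "x \<in> arc (- a - of_nat m) m"
  then obtain i where i: "i \<le> m" "x = - a - of_nat m + of_nat i" by (auto simp: arc_def)
  then have "x = - (a + of_nat (m - i))" by (simp add: of_nat_diff)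
  then show "x \<in> uminus ` arc a m" unfolding arc_def by (metis atMost_iff diff_le_self imageI)
qed

section \<open>Dilations between intervals\<close>

text \<open>The start is the only point of a proper arc whose predecessor lies outside the
  arc.\<close>

lemma arc_start_inj:
  assumes "arc a m = (arc b m :: 'p::prime_card mod_ring set)" "m + 1 < CARD('p)"
  shows "a = b"
proof -
  have pred: "x = b" if x: "x \<in> arc b m" "x - 1 \<notin> arc b m" for x
  proof -
    obtain i where i: "i \<le> m" "x = b + of_nat i" using x(1) by (auto simp: arc_def)
    have "i = 0"
    proof (rule ccontr)
      assume "i \<noteq> 0"
      then have "x - 1 = b + of_nat (i - 1)" using i by (simp add: of_nat_diff)
      moreover have "i - 1 \<le> m" using i by simp
      ultimately show False using x(2) unfolding arc_def by blast
    qed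
    then show ?thesis using i by simp
  qed
  have "a - 1 \<notin> arc a m"
  proof
    assume "a - 1 \<in> arc a m"
    then obtain i where "i \<le> m" "(of_nat (Suc i) :: 'p mod_ring) = of_nat 0"
      by (auto simp: arc_def algebra_simps)
    then show False using of_nat_mod_ring_eq_iff[of "Suc i" 0, where 'p='p] assms(2) by simp
  qed
  moreover have "a \<in> arc a m" by (auto simp: arc_def intro: image_eqI[of _ _ 0])
  ultimately show ?thesis using pred assms(1) by simp
qed

text \<open>A dilate of an arc by \<open>t\<close> is a progression of difference \<open>t\<close>,
  so a step of \<open>t\<close> can leave it only from the last term.\<close>

lemma dilated_arc_exit_unique:
  fixes t :: "'p::prime_card mod_ring"
  assumes "(*) t ` arc a m = S" "x \<in> S" "x + t \<notin> S" "y \<in> S" "y + t \<notin> S"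
  shows "x = y"
proof -
  have "x = t * (a + of_nat m)" if x: "x \<in> S" "x + t \<notin> S" for x
  proof -
    obtain i where i: "i \<le> m" "x = t * (a + of_nat i)" using x(1) assms(1) by (auto simp: arc_def)
    have "\<not> Suc i \<le> m"
    proof
      assume "Suc i \<le> m"
      then have "a + of_nat (Suc i) \<in> arc a m" unfolding arc_def by blast
      then have "t * (a + of_nat (Suc i)) \<in> S" using assms(1) by blast
      then show False using i(2) x(2) by (simp add: algebra_simps)
    qed
    then have "i = m" using i(1) by simp
    then show ?thesis using i(2) by simp
  qed
  then show ?thesis using assms by metis
qed

text \<open>For \<open>t \<ge> 2\<close>, a step of \<open>t\<close> leaves the interval from both
  of its last two points; \<open>m + t < CARD('p)\<close> prevents it from wrapping back in.\<close>

lemma arc_dilation_small: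
  fixes a b :: "'p::prime_card mod_ring"
  assumes eq: "(*) (of_nat t) ` arc a m = arc b m"
    and m: "1 \<le> m" and t: "1 \<le> t" "m + t < CARD('p)"
  shows "t = 1"
proof (rule ccontr)
  assume "t \<noteq> 1"
  then have t2: "2 \<le> t" using t by simp
  have out: "b + of_nat i \<notin> arc b m" if "m < i" "i < CARD('p)" for i
  proof
    assume "b + of_nat i \<in> arc b m"
    then obtain j where "j \<le> m" "(of_nat i :: 'p mod_ring) = of_nat j" by (auto simp: arc_def)
    then show False using of_nat_mod_ring_eq_iff[of i j, where 'p='p] that by simp
  qed
  have inn: "b + of_nat i \<in> arc b m" if "i \<le> m" for i using that unfolding arc_def by blast
  have "b + of_nat m = b + of_nat (m - 1)"
  proof (rule dilated_arc_exit_unique[OF eq])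
    show "b + of_nat m \<in> arc b m" "b + of_nat (m - 1) \<in> arc b m" using inn by simp_all
    show "b + of_nat m + of_nat t \<notin> arc b m" using out[of "m + t"] t by (simp add: add.assoc)
    have "b + of_nat (m - 1) + of_nat t = b + of_nat (m - 1 + t)" by (simp only: of_nat_add add.assoc)
    moreover have "b + of_nat (m - 1 + t) \<notin> arc b m" by (rule out) (use t t2 m in auto)
    ultimately show "b + of_nat (m - 1) + of_nat t \<notin> arc b m" by (simp only: not_False_eq_True)
  qed
  then show False using of_nat_mod_ring_eq_iff[of m "m - 1", where 'p='p] m t by auto
qed

text \<open>Either \<open>t\<close> or \<open>- t\<close> has a representative short enough for
  \<open>arc_dilation_small\<close>, because \<open>2 * m < CARD('p)\<close>; the second case goes
  through the reflection.\<close>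

lemma arc_dilation:
  fixes t a b :: "'p::prime_card mod_ring"
  assumes eq: "(*) t ` arc a m = arc b m" and t: "t \<noteq> 0" and m: "1 \<le> m" "2 * m < CARD('p)"
  shows "a = b \<or> b = - a - of_nat m"
proof -
  obtain i where i: "i < CARD('p)" "t = of_nat i" using surj_of_nat_mod_ring by blast
  then have i0: "1 \<le> i" using t by (cases i) auto
  have m1: "m + 1 < CARD('p)" using m by linarith
  show ?thesis
  proof (cases "m + i < CARD('p)")
    case True
    then have "i = 1" using arc_dilation_small[of i a m b] eq i i0 m by simp
    then have "arc a m = arc b m" using eq i by simp
    then show ?thesis using arc_start_inj m1 by blast
  next
    case False
    have "(*) (- t) ` arc a m = uminus ` (*) t ` arc a m" by (simp add: image_image)
    then have eq': "(*) (- t) ` arc a m = arc (- b - of_nat m) m" using eq by (simp add: uminus_arc)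
    have mt: "- t = of_nat (CARD('p) - i)" using i by (simp add: of_nat_diff)
    have "CARD('p) - i = 1"
      by (rule arc_dilation_small[OF eq'[unfolded mt] m(1)]) (use i i0 m False in auto)
    then have "arc a m = arc (- b - of_nat m) m" using eq' mt by simp
    then have "a = - b - of_nat m" using m1 by (rule arc_start_inj)
    then show ?thesis by simp
  qed
qed

text \<open>An isomorphism of cylinders preserves the hyperplane of vanishing coordinate
  \<open>c\<close>, so it acts on that coordinate as multiplication by a scalar. This brings
  non-isomorphism down to arcs in the prime field.\<close>

lemma cylinder_isomorphic_dilation:
  fixes S T :: "'p::prime_card mod_ring set" and c :: "'n::finite"
  assumes "set_isomorphic (cylinder c S) (cylinder c T)" "T \<noteq> {}" "T \<noteq> UNIV"
  obtains t where "t \<noteq> 0" "(*) t ` S = T"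
proof -
  obtain f :: "'p mod_ring ^ 'n \<Rightarrow> 'p mod_ring ^ 'n"
    where f: "bij f" "\<And>x y. f (x + y) = f x + f y" "f ` cylinder c S = cylinder c T"
    using assms(1) unfolding set_isomorphic_def by blast
  \<comment> \<open>Adding \<open>h\<close> preserves \<open>cylinder c S\<close>, so \<open>f h $ c\<close> is a period of the proper subset \<open>T\<close> of \<open>\<F>\<^sub>p\<close>.\<close>
  have period: "f h $ c = 0" if h: "h $ c = 0" for h
  proof (rule ccontr)
    assume nz: "f h $ c \<noteq> 0"
    have "T = UNIV"
    proof (rule closed_under_diff_UNIV[OF assms(2) nz])
      fix x assume "x \<in> T"
      then have "axis c x \<in> cylinder c T" by (simp add: cylinder_def axis_def)
      then obtain y where y: "y \<in> cylinder c S" "axis c x = f y" using f(3) by blast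
      have "y - h \<in> cylinder c S" using y(1) h by (simp add: cylinder_def)
      then have "f (y - h) \<in> cylinder c T" using f(3) by blast
      moreover have "f (y - h) = axis c x - f h" using f(2)[of "y - h" h] y(2) by simp
      ultimately show "x - f h $ c \<in> T" by (simp add: cylinder_def axis_def)
    qed
    then show False using assms(3) by simp
  qed
  define t where "t = f (axis c 1) $ c"
  have ft: "f x $ c = t * x $ c" for x
  proof -
    have "f x = f (x $ c *s axis c 1) + f (x - x $ c *s axis c 1)" by (simp flip: f(2))
    moreover have "f (x - x $ c *s axis c 1) $ c = 0" by (rule period) (simp add: axis_def)
    moreover have "f (x $ c *s axis c 1) = x $ c *s f (axis c 1)"
      by (rule additive_mod_ring_scale) (rule f(2))
    ultimately show ?thesis by (simp add: t_def mult.commute)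
  qed
  have im: "(\<lambda>x. x $ c) ` cylinder c U = U" for U :: "'p mod_ring set"
  proof -
    have "u \<in> (\<lambda>x. x $ c) ` cylinder c U" if "u \<in> U" for u
      by (rule image_eqI[of _ _ "axis c u"]) (use that in \<open>simp_all add: cylinder_def axis_def\<close>)
    then show ?thesis by (auto simp: cylinder_def)
  qed
  have "T = (\<lambda>x. x $ c) ` f ` cylinder c S" using f(3) im by simp
  also have "\<dots> = (*) t ` (\<lambda>x. x $ c) ` cylinder c S" by (simp add: image_image ft)
  finally have "(*) t ` S = T" using im by simp
  moreover have "t \<noteq> 0"
  proof
    assume "t = 0"
    obtain y where "axis c 1 = f y" using f(1) by (metis bij_pointE)
    then have "f y $ c = 1" by (metis axis_nth)
    then show False using ft[of y] \<open>t = 0\<close> by simp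
  qed
  ultimately show thesis using that by blast
qed

section \<open>Classification of the extremal sets\<close>

context
  fixes k l m lam :: nat
  assumes kl: "l < k" "1 \<le> l" and m: "1 \<le> m" and lam: "lam + 3 \<le> k + l"
    and p: "CARD('p::prime_card) = (k + l) * m + 2 + lam"
begin

lemma param_bounds: "k - l < CARD('p)" "2 * m < CARD('p)" "m < CARD('p)" "m + 1 < CARD('p)"
proof -
  have "k + l \<le> (k + l) * m" "2 * m \<le> (k + l) * m" "m \<le> (k + l) * m" using m kl by simp_all
  then show "k - l < CARD('p)" "2 * m < CARD('p)" "m < CARD('p)" "m + 1 < CARD('p)"
    using p kl by linarith+
qed

lemma extremal_set_cylinder:
  "(extremal_set c k l m j :: ('p mod_ring ^ 'n::finite) set) = cylinder c (arc (extremal_start k l m j) m)"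
  by (rule extremal_set_eq) (rule param_bounds)

lemma extremal_sum_free_extremal_set:
  assumes "j \<le> lam"
  shows "extremal_sum_free k l m (extremal_set c k l m j :: ('p mod_ring ^ 'n::finite) set)"
proof -
  have "(of_nat k - of_nat l) * extremal_start k l m j = - (of_nat (k * m + 1 + j) :: 'p mod_ring)"
    using extremal_start_iff[OF kl(1) param_bounds(1)] by blast
  then have "kl_sum_free k l (arc (extremal_start k l m j) m :: 'p mod_ring set)"
    using arc_sum_free_iff[OF p] assms by blast
  moreover have "card (arc (extremal_start k l m j) m :: 'p mod_ring set) = m + 1"
    by (rule card_arc) (rule param_bounds)
  ultimately show ?thesis
    by (simp only: extremal_sum_free_def extremal_set_cylinder kl_sum_free_cylinder card_cylinder
        CARD_mod_ring)
qed

lemma extremal_start_reflect: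
  assumes "j \<le> lam"
  shows "- extremal_start k l m j - of_nat m = (extremal_start k l m (lam - j) :: 'p mod_ring)"
proof -
  define a :: "'p mod_ring" where "a = extremal_start k l m j"
  have a: "(of_nat k - of_nat l) * a = - of_nat (k * m + 1 + j)"
    using extremal_start_iff[OF kl(1) param_bounds(1)] a_def by blast
  have "(of_nat k - of_nat l) * (- a - of_nat m) = - ((of_nat k - of_nat l) * a) - (of_nat k - of_nat l) * of_nat m"
    by (simp add: algebra_simps)
  also have "\<dots> = of_nat (k * m + 1 + j) - (of_nat k - of_nat l) * of_nat m"
    by (simp only: a minus_minus)
  also have "\<dots> = of_nat (l * m + 1 + j)" by (simp add: algebra_simps)
  \<comment> \<open>Subtracting the field order, which is zero in the field, trades
    \<open>l * m + 1 + j\<close> for the negative of the parameter that belongs to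
    \<open>lam - j\<close>.\<close>
  also have "\<dots> = of_nat (l * m + 1 + j) - (of_nat CARD('p) :: 'p mod_ring)" by simp
  also have "CARD('p) = (l * m + 1 + j) + (k * m + 1 + (lam - j))"
    using p assms by (simp add: algebra_simps)
  also have "of_nat (l * m + 1 + j) - of_nat \<dots> = - (of_nat (k * m + 1 + (lam - j)) :: 'p mod_ring)"
    by (simp only: of_nat_add)
       simp
  finally show ?thesis using extremal_start_iff[OF kl(1) param_bounds(1)] a_def by blast
qed

text \<open>Negation pairs \<open>j\<close> with \<open>lam - j\<close>, which is why only
  \<open>j \<le> lam div 2\<close> are counted.\<close>

lemma extremal_set_reflect:
  assumes "j \<le> lam"
  shows "set_isomorphic (extremal_set c k l m j :: ('p mod_ring ^ 'n::finite) set)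
           (extremal_set c k l m (lam - j))"
proof -
  have "(*) (- 1) ` arc (extremal_start k l m j) m = (arc (extremal_start k l m (lam - j)) m :: 'p mod_ring set)"
    using uminus_arc[of "extremal_start k l m j :: 'p mod_ring" m]
    by (simp add: extremal_start_reflect[OF assms] image_def)
  then show ?thesis
    using cylinder_scale_isomorphic[of "- 1" c "arc (extremal_start k l m j) m :: 'p mod_ring set"]
    by (simp add: extremal_set_cylinder)
qed

lemma extremal_start_inj:
  assumes "i \<le> lam" "j \<le> lam" "extremal_start k l m i = (extremal_start k l m j :: 'p mod_ring)"
  shows "i = j"
proof -
  have "(of_nat (k * m + 1 + i) :: 'p mod_ring) = of_nat (k * m + 1 + j)"
    using extremal_start_iff[OF kl(1) param_bounds(1)] assms(3) by (metis neg_equal_iff_equal)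
  moreover have "k * m + 1 + lam < CARD('p)" using p by (simp add: algebra_simps)
  then have "k * m + 1 + i < CARD('p)" "k * m + 1 + j < CARD('p)" using assms(1,2) by linarith+
  ultimately have "k * m + 1 + i = k * m + 1 + j" using of_nat_mod_ring_eq_iff by blast
  then show ?thesis by simp
qed

lemma extremal_sets_non_isomorphic:
  assumes iso: "set_isomorphic (extremal_set c k l m i :: ('p mod_ring ^ 'n::finite) set)
                  (extremal_set c k l m j)"
    and ij: "i \<le> lam div 2" "j \<le> lam div 2"
  shows "i = j"
proof -
  let ?a = "\<lambda>j. extremal_start k l m j :: 'p mod_ring"
  have c: "card (arc (?a j) m) = m + 1" by (rule card_arc) (rule param_bounds)
  then have "arc (?a j) m \<noteq> {}" "arc (?a j) m \<noteq> UNIV" using param_bounds(4) by auto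
  then obtain t where t: "t \<noteq> 0" "(*) t ` arc (?a i) m = arc (?a j) m"
    by (rule cylinder_isomorphic_dilation[OF iso[unfolded extremal_set_cylinder]])
  have ij': "i \<le> lam" "j \<le> lam" "lam - i \<le> lam" using ij by linarith+
  have "?a i = ?a j \<or> ?a j = ?a (lam - i)"
    using arc_dilation[OF t(2,1) m param_bounds(2)] by (simp only: extremal_start_reflect[OF ij'(1)])
  then have "i = j \<or> j = lam - i" using extremal_start_inj ij' by blast
  \<comment> \<open>With both indices at most \<open>lam div 2\<close>, even
    \<open>j = lam - i\<close> forces \<open>i = j\<close>.\<close>
  then show ?thesis using ij by linarith
qed

lemma sum_free_card_bound:
  fixes A :: "('p mod_ring ^ 'n::finite) set"
  assumes "kl_sum_free k l A"
  shows "card A \<le> (m + 1) * CARD('p) ^ (CARD('n) - 1)"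
proof (rule ccontr)
  assume "\<not> ?thesis"
  then have lt: "(m + 1) * CARD('p) ^ (CARD('n) - 1) < card A" by simp
  show False
    by (rule large_sum_free_periodic[OF assms kl m lam p less_imp_le[OF lt]]) (use lt in simp)
qed

text \<open>The normal form is reached in stages: periodicity makes \<open>A\<close> a cylinder,
  Vosper makes its base a progression, dilation makes that an interval, disjointness fixes its
  start, and reflection halves the range of \<open>j\<close>.\<close>

lemma extremal_sum_free_isomorphic:
  fixes A :: "('p mod_ring ^ 'n::finite) set" and c :: 'n
  assumes ext: "extremal_sum_free k l m A"
  obtains j where "j \<le> lam div 2" "set_isomorphic A (extremal_set c k l m j)"
proof -
  have sf: "kl_sum_free k l A" and cA: "card A = (m + 1) * CARD('p) ^ (CARD('n) - 1)"
    using ext by (auto simp: extremal_sum_free_def)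
  obtain H where H: "add_subgroup H" "card H = CARD('p) ^ (CARD('n) - 1)" "H + A = A"
    by (rule large_sum_free_periodic[OF sf kl m lam p eq_imp_le[OF cA[symmetric]]])
  obtain S where S: "set_isomorphic A (cylinder c S)"
    by (rule large_sum_free_cylinder[OF H])
  have sfS: "kl_sum_free k l S"
    using kl_sum_free_isomorphic[OF S sf] by (simp add: kl_sum_free_cylinder)
  have cS: "card S = m + 1"
  proof -
    have "card S * CARD('p) ^ (CARD('n) - 1) = (m + 1) * CARD('p) ^ (CARD('n) - 1)"
      using card_isomorphic[OF S] cA by (simp only: card_cylinder CARD_mod_ring)
    then show ?thesis by (subst (asm) mult_right_cancel) auto
  qed
  have "is_arith_prog S"
  proof (rule sum_free_arith_prog[OF sfS kl cS m])
    show "CARD('p) < (k + l) * (m + 1)" using p lam by simp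
  qed
  then obtain a d where d: "d \<noteq> 0" and S': "S = (\<lambda>i. a + of_nat i * d) ` {..<m + 1}"
    unfolding is_arith_prog_def cS by blast
  have "(*) (inverse d) ` S = arc (inverse d * a) m"
    unfolding S' arc_def image_image using d
    by (intro image_cong) (auto simp: algebra_simps)
  then have iso: "set_isomorphic A (cylinder c (arc (inverse d * a) m))"
    using set_isomorphic_trans[OF S cylinder_scale_isomorphic[of "inverse d" c S]] d by simp
  have "kl_sum_free k l (arc (inverse d * a) m)"
    using kl_sum_free_isomorphic[OF iso sf] by (simp add: kl_sum_free_cylinder)
  then obtain j where j: "j \<le> lam" "(of_nat k - of_nat l) * (inverse d * a) = - of_nat (k * m + 1 + j)"
    using arc_sum_free_iff[OF p] by blast
  then have "inverse d * a = extremal_start k l m j"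
    using extremal_start_iff[OF kl(1) param_bounds(1)] by blast
  then have iso_j: "set_isomorphic A (extremal_set c k l m j)"
    using iso by (simp add: extremal_set_cylinder)
  show thesis
  proof (cases "j \<le> lam div 2")
    case True
    then show thesis using that iso_j by blast
  next
    case False
    then have "lam - j \<le> lam div 2" by linarith
    then show thesis using that set_isomorphic_trans[OF iso_j extremal_set_reflect[OF j(1)]] by blast
  qed
qed

lemma extremal_sum_free_iff:
  fixes A :: "('p mod_ring ^ 'n::finite) set" and c :: 'n
  shows "extremal_sum_free k l m A \<longleftrightarrow> (\<exists>j\<le>lam div 2. set_isomorphic A (extremal_set c k l m j))"
proof
  assume "extremal_sum_free k l m A"
  then show "\<exists>j\<le>lam div 2. set_isomorphic A (extremal_set c k l m j)"
    by (rule extremal_sum_free_isomorphic) blast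
next
  assume "\<exists>j\<le>lam div 2. set_isomorphic A (extremal_set c k l m j)"
  then obtain j where j: "j \<le> lam div 2" "set_isomorphic (extremal_set c k l m j) A"
    using set_isomorphic_sym by blast
  have "extremal_sum_free k l m (extremal_set c k l m j :: ('p mod_ring ^ 'n) set)"
    using j(1) by (intro extremal_sum_free_extremal_set) linarith
  then show "extremal_sum_free k l m A"
    using kl_sum_free_isomorphic[OF j(2)] card_isomorphic[OF j(2)] by (simp add: extremal_sum_free_def)
qed

lemma card_extremal_classes:
  "card ({A :: ('p mod_ring ^ 'n::finite) set. extremal_sum_free k l m A} // {(A, B). set_isomorphic A B})
     = lam div 2 + 1"
proof -
  \<comment> \<open>The number of classes does not depend on a coordinate; any \<open>c\<close>
    supplies the representatives.\<close>
  fix c :: 'n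
  let ?r = "{(A :: ('p mod_ring ^ 'n) set, B). set_isomorphic A B}"
  let ?cls = "\<lambda>j. ?r `` {extremal_set c k l m j :: ('p mod_ring ^ 'n) set}"
  have eq_iff: "?r `` {A} = ?r `` {B} \<longleftrightarrow> set_isomorphic A B" for A B
    using eq_equiv_class_iff[OF equiv_set_isomorphic, of A B] by simp
  have "{A. extremal_sum_free k l m A} // ?r = ?cls ` {..lam div 2}"
  proof (intro Set.equalityI subsetI)
    fix X assume "X \<in> {A. extremal_sum_free k l m A} // ?r"
    then obtain A where A: "extremal_sum_free k l m A" "X = ?r `` {A}" by (auto elim!: quotientE)
    then obtain j where "j \<le> lam div 2" "set_isomorphic A (extremal_set c k l m j)"
      using extremal_sum_free_iff by blast
    then show "X \<in> ?cls ` {..lam div 2}" using A(2) eq_iff by blast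
  next
    fix X assume "X \<in> ?cls ` {..lam div 2}"
    then obtain j where j: "j \<le> lam div 2" "X = ?cls j" by blast
    then have "extremal_sum_free k l m (extremal_set c k l m j :: ('p mod_ring ^ 'n) set)"
      using extremal_sum_free_iff set_isomorphic_refl by blast
    then show "X \<in> {A. extremal_sum_free k l m A} // ?r" unfolding j(2) by (intro quotientI) simp
  qed
  moreover have "inj_on ?cls {..lam div 2}"
    by (rule inj_onI) (use eq_iff extremal_sets_non_isomorphic in blast)
  ultimately show ?thesis by (simp add: card_image)
qed

end

theorem theorem1p3:
  fixes k l m lam p n :: nat
    and c :: "'n::finite"
  assumes "k > l" and "l \<ge> 1" and "m \<ge> 1"
    and "lam \<in> {0..k + l - 3}"
    and "p = CARD('p::prime_card)"
    and "p = (k + l) * m + 2 + lam"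
    and "n = CARD('n)"
  shows "(\<forall>A :: ('p mod_ring ^ 'n) set. kl_sum_free k l A \<longrightarrow> card A \<le> (m + 1) * p ^ (n - 1))
    \<and> int (card ({A :: ('p mod_ring ^ 'n) set. extremal_sum_free k l m A}
                   // {(A, B). set_isomorphic A B})) = \<lceil>(real lam + 1) / 2\<rceil>
    \<and> (\<forall>A :: ('p mod_ring ^ 'n) set. kl_sum_free k l A \<longrightarrow>
         (card A = (m + 1) * p ^ (n - 1) \<longleftrightarrow>
            (\<exists>j::nat. int j \<in> {0..\<lceil>(real lam + 1) / 2\<rceil> - 1}
               \<and> set_isomorphic A (extremal_set c k l m j))))
    \<and> (\<forall>i j :: nat. int i \<in> {0..\<lceil>(real lam + 1) / 2\<rceil> - 1} \<longrightarrow>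
         int j \<in> {0..\<lceil>(real lam + 1) / 2\<rceil> - 1} \<longrightarrow> i \<noteq> j \<longrightarrow>
         \<not> set_isomorphic (extremal_set c k l m i :: ('p mod_ring ^ 'n) set)
                          (extremal_set c k l m j))
    \<and> (lam \<in> {0, 1} \<longrightarrow>
         (\<exists>A :: ('p mod_ring ^ 'n) set. extremal_sum_free k l m A) \<and>
         (\<forall>A B :: ('p mod_ring ^ 'n) set. extremal_sum_free k l m A \<longrightarrow>
            extremal_sum_free k l m B \<longrightarrow> set_isomorphic A B))"
proof -
  \<comment> \<open>The subtraction in \<open>k + l - 3\<close> is not truncated, as
    \<open>k \<ge> 2\<close> and \<open>l \<ge> 1\<close>.\<close>
  have lam: "lam + 3 \<le> k + l" using assms(1,2,4) by auto
  have p: "CARD('p) = (k + l) * m + 2 + lam" using assms(5,6) by simp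
  note params = assms(1-3) lam p
  \<comment> \<open>For odd \<open>lam\<close> the quotient is already an integer; for even
    \<open>lam\<close> it is rounded up by one half.\<close>
  have ceil: "\<lceil>(real lam + 1) / 2\<rceil> = int (lam div 2 + 1)"
  proof (rule ceiling_unique)
    have "lam = 2 * (lam div 2) \<or> lam = 2 * (lam div 2) + 1" by linarith
    then have "real lam = 2 * real (lam div 2) \<or> real lam = 2 * real (lam div 2) + 1" by linarith
    then show "real_of_int (int (lam div 2 + 1)) - 1 < (real lam + 1) / 2"
      "(real lam + 1) / 2 \<le> real_of_int (int (lam div 2 + 1))" by auto
  qed
  have range: "int j \<in> {0..\<lceil>(real lam + 1) / 2\<rceil> - 1} \<longleftrightarrow> j \<le> lam div 2" for j
    unfolding ceil by auto
  have iff: "extremal_sum_free k l m A \<longleftrightarrow> (\<exists>j\<le>lam div 2. set_isomorphic A (extremal_set c k l m j))"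
    for A :: "('p mod_ring ^ 'n) set"
    by (rule extremal_sum_free_iff[OF params])
  show ?thesis
    unfolding range
  proof (intro conjI allI impI)
    fix A :: "('p mod_ring ^ 'n) set" assume sf: "kl_sum_free k l A"
    show "card A \<le> (m + 1) * p ^ (n - 1)"
      using sum_free_card_bound[OF params sf] assms(5,7) by simp
    show "card A = (m + 1) * p ^ (n - 1) \<longleftrightarrow>
        (\<exists>j\<le>lam div 2. set_isomorphic A (extremal_set c k l m j))"
      unfolding iff[symmetric] extremal_sum_free_def assms(5,7) using sf by blast
  next
    show "int (card ({A :: ('p mod_ring ^ 'n) set. extremal_sum_free k l m A}
                   // {(A, B). set_isomorphic A B})) = \<lceil>(real lam + 1) / 2\<rceil>"
      unfolding ceil card_extremal_classes[OF params] ..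
  next
    fix i j assume "i \<le> lam div 2" "j \<le> lam div 2" "i \<noteq> j"
    then show "\<not> set_isomorphic (extremal_set c k l m i :: ('p mod_ring ^ 'n) set) (extremal_set c k l m j)"
      using extremal_sets_non_isomorphic[OF params] by blast
  next
    show "\<exists>A :: ('p mod_ring ^ 'n) set. extremal_sum_free k l m A"
      using extremal_sum_free_extremal_set[OF params] by blast
  next
    fix A B :: "('p mod_ring ^ 'n) set"
    assume "lam \<in> {0, 1}" "extremal_sum_free k l m A" "extremal_sum_free k l m B"
    moreover from this(1) have "lam div 2 = 0" by auto
    ultimately show "set_isomorphic A B"
      unfolding iff using set_isomorphic_sym set_isomorphic_trans by (metis le_zero_eq)
  qed
qed

end
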